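(* Let $0<r<2$ and let $G=\{G(x),x\in\mathbb{R}\}$ be a fractional Brownian motion with $E(G(x+h)-G(x))^2=\sigma^2(h)=|h|^r$. Then for every $1\le p<\infty$, almost surely, $$\lim_{h\to0}\int_a^b\left|\frac{G(x+h)-G(x)}{\sigma(h)}\right|^p dx=E|\eta|^p\,(b-a)$$ for all real $a<b$.
   Context: A fractional Brownian motion here is a real-valued mean-zero Gaussian process on $\mathbb{R}$ with stationary increments, $G(0)=0$ and $E(G(x+h)-G(x))^2=|h|^r$, taken with continuous sample paths. $\sigma(h)=|h|^{r/2}$. $\eta$ is a normal random variable with mean zero and variance one. *)

theory Defs
  imports "HOL-Probability.Probability"
begin

text \<open>Degenerate (almost surely constant) normal variables are admitted, so that, e.g.,
  a process with \<open>G 0 = 0\<close> can be Gaussian; \<^const>\<open>normal_density\<close> only covers positive variance.\<close>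

definition gaussian_rv :: "'a measure \<Rightarrow> ('a \<Rightarrow> real) \<Rightarrow> bool" where
  "gaussian_rv M X \<longleftrightarrow>
     X \<in> borel_measurable M \<and>
     (\<exists>\<mu> s. (s > 0 \<and> distributed M lborel X (normal_density \<mu> s)) \<or>
            (AE \<omega> in M. X \<omega> = \<mu>))"

definition gaussian_process :: "'a measure \<Rightarrow> ('t \<Rightarrow> 'a \<Rightarrow> real) \<Rightarrow> bool" where
  "gaussian_process M G \<longleftrightarrow>
     (\<forall>T c. finite T \<longrightarrow> gaussian_rv M (\<lambda>\<omega>. \<Sum>t\<in>T. c t * G t \<omega>))"

text \<open>Equality of all finite-dimensional distributions of \<open>x \<mapsto> G (x + h) - G h\<close>
  and \<open>x \<mapsto> G x - G 0\<close>.\<close>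

definition stationary_increments :: "'a measure \<Rightarrow> (real \<Rightarrow> 'a \<Rightarrow> real) \<Rightarrow> bool" where
  "stationary_increments M G \<longleftrightarrow>
     (\<forall>h T. finite T \<longrightarrow>
        distr M (Pi\<^sub>M T (\<lambda>_. borel)) (\<lambda>\<omega>. \<lambda>x\<in>T. G (x + h) \<omega> - G h \<omega>) =
        distr M (Pi\<^sub>M T (\<lambda>_. borel)) (\<lambda>\<omega>. \<lambda>x\<in>T. G x \<omega> - G 0 \<omega>))"

text \<open>The parameter \<open>r\<close> is the exponent of the variance of the increments, i.e. twice the Hurst index.\<close>

definition fractional_brownian_motion ::
    "'a measure \<Rightarrow> real \<Rightarrow> (real \<Rightarrow> 'a \<Rightarrow> real) \<Rightarrow> bool" where
  "fractional_brownian_motion M r G \<longleftrightarrow>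
     prob_space M \<and>
     gaussian_process M G \<and>
     (\<forall>x. prob_space.expectation M (G x) = 0) \<and>
     stationary_increments M G \<and>
     (\<forall>\<omega>\<in>space M. G 0 \<omega> = 0) \<and>
     (\<forall>x h. prob_space.expectation M (\<lambda>\<omega>. (G (x + h) \<omega> - G x \<omega>)\<^sup>2) = \<bar>h\<bar> powr r) \<and>
     (\<forall>\<omega>\<in>space M. continuous_on UNIV (\<lambda>x. G x \<omega>))"

definition fbm_sigma :: "real \<Rightarrow> real \<Rightarrow> real" where
  "fbm_sigma r h = \<bar>h\<bar> powr (r / 2)"

end

theory Submission
  imports Defs "HOL-Real_Asymp.Real_Asymp"
begin

text \<open>Write \<open>Z\<^sub>h(x)\<close> for the increment of \<open>G\<close> over \<open>[x, x + h]\<close> divided by \<open>\<sigma>(h)\<close>. Each \<open>Z\<^sub>h(x)\<close>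
is standard normal, and the correlation of \<open>Z\<^sub>h(x)\<close> and \<open>Z\<^sub>h(y)\<close> depends only on
\<open>v = (x - y) / h\<close>; it is a second difference of \<open>\<bar>v\<bar> powr r\<close>, hence at most of order
\<open>\<bar>v\<bar> powr (r - 2)\<close> for large \<open>v\<close>. So for small \<open>h\<close> the values of \<open>Z\<^sub>h\<close> at distinct points are nearly independent and
the averages of \<open>f(Z\<^sub>h)\<close> over \<open>[a, b]\<close> obey a law of large numbers with limit \<open>E f(\<eta>)\<close>.
Three points make this precise.

\<^item> The variance of such an average is computed for \<open>f(x) = cos (t x)\<close> and \<open>f = cosh\<close>. These satisfy
  \<open>2 f(x) f(y) = f(x + y) + f(x - y)\<close>, so that the covariance of \<open>f(X)\<close> and \<open>f(Y)\<close> for jointly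
  normal \<open>X\<close> and \<open>Y\<close> involves only the one-dimensional laws of \<open>X + Y\<close> and \<open>X - Y\<close>
  (\<open>dalembert_correlated\<close>). The variance is at most a constant times a power of \<open>h\<close>, hence
  summable along \<open>h = q ^ n\<close> for every \<open>q < 1\<close>, and this gives almost sure convergence along this sequence
  (\<open>dalembert_average_converges\<close>).

\<^item> The function \<open>\<bar>x\<bar> powr p\<close> is within \<open>e * cosh x\<close> of a polynomial in \<open>cos (s x)\<close>, for each
  \<open>e > 0\<close> (\<open>powr_approx_cos_polynomial\<close>). Such a polynomial is a linear combination of cosines,
  and the average of \<open>cosh (Z\<^sub>h)\<close> stays bounded, so the limit passes to \<open>\<bar>x\<bar> powr p\<close>
  (\<open>averages_to_normal_powr\<close>, \<open>fbm_geometric_limit\<close>).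

\<^item> The passage from geometric sequences to all \<open>h\<close> is a deterministic fact about continuous
  paths. The \<open>L\<^sup>p\<close> norm of the increment is subadditive in the step, up to translating the
  interval. The limit along \<open>h = (1/2) ^ n\<close> bounds this norm by \<open>C * h powr (r / 2)\<close> for dyadic
  \<open>h\<close>, and adding up binary digits extends the bound to all steps (\<open>chaining_dyadic\<close>). An
  arbitrary \<open>h\<close> differs from the nearest power of \<open>q\<close> by a small fraction of \<open>h\<close> if \<open>q\<close> is close
  to 1; that remainder contributes little by the bound just obtained
  (\<open>limit_from_geometric\<close>).

Only countably many null sets occur: one for each pair of rational endpoints and each
\<open>q = (m + 1) / (m + 2)\<close>. Real endpoints and negative \<open>h\<close> follow by squeezing the interval between
rational ones, because a step \<open>h < 0\<close> is a step \<open>\<bar>h\<bar>\<close> on a translated interval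
(\<open>limit_from_rational_intervals\<close>).\<close>

section \<open>Integrated powers of the increments of a path\<close>

lemma powr_convex_nonneg:
  fixes p t x y :: real
  assumes "1 \<le> p" "0 \<le> t" "t \<le> 1" "0 \<le> x" "0 \<le> y"
  shows "((1 - t) * x + t * y) powr p \<le> (1 - t) * x powr p + t * y powr p"
proof -
  have le: "(s * z) powr p \<le> s * z powr p" if "0 \<le> s" "s \<le> 1" "0 \<le> z" for s z :: real
    using that assms(1) powr_le_one_le[of s p]
    by (cases "s = 0") (auto simp: powr_mult intro!: mult_right_mono)
  consider "x = 0" | "y = 0" | "0 < x" "0 < y" using assms by linarith
  then show ?thesis
  proof cases
    case 1 then show ?thesis using le[of t y] assms by simp
  next
    case 2 then show ?thesis using le[of "1 - t" x] assms by simp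
  next
    case 3
    then show ?thesis
      using convex_onD[OF powr_convex[OF assms(1)], of t x y] assms by simp
  qed
qed

lemma continuous_on_abs_powr:
  fixes u :: "real \<Rightarrow> real"
  assumes "1 \<le> p" "continuous_on S u"
  shows "continuous_on S (\<lambda>x. \<bar>u x\<bar> powr p)"
  using assms by (intro continuous_on_powr' continuous_on_rabs continuous_on_const) auto

text \<open>Minkowski's inequality by convexity of \<open>x powr p\<close>: the sum is \<open>A + B\<close> times the convex
combination of \<open>f / A\<close> and \<open>g / B\<close> with weights \<open>A / (A + B)\<close> and \<open>B / (A + B)\<close>. Arbitrary positive
upper bounds \<open>A\<close>, \<open>B\<close> in place of the norms avoid a case distinction for vanishing norms.\<close>
lemma minkowski_interval:
  fixes f g :: "real \<Rightarrow> real"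
  assumes p: "1 \<le> p" and f: "continuous_on {a..b} f" and g: "continuous_on {a..b} g"
    and A: "0 < A" "integral {a..b} (\<lambda>x. \<bar>f x\<bar> powr p) \<le> A powr p"
    and B: "0 < B" "integral {a..b} (\<lambda>x. \<bar>g x\<bar> powr p) \<le> B powr p"
  shows "integral {a..b} (\<lambda>x. \<bar>f x + g x\<bar> powr p) \<le> (A + B) powr p"
proof -
  define t where "t = B / (A + B)"
  have pos: "A + B > 0" using A(1) B(1) by simp
  have t: "0 \<le> t" "t \<le> 1" "1 - t = A / (A + B)"
    using A(1) B(1) pos by (simp_all add: t_def divide_simps)
  have pw: "\<bar>f x + g x\<bar> powr p \<le> (A + B) powr p *
      ((1 - t) / A powr p * \<bar>f x\<bar> powr p + t / B powr p * \<bar>g x\<bar> powr p)" for x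
  proof -
    have "\<bar>f x + g x\<bar> \<le> (A + B) * ((1 - t) * (\<bar>f x\<bar> / A) + t * (\<bar>g x\<bar> / B))"
    proof -
      have "(A + B) * ((1 - t) * (\<bar>f x\<bar> / A) + t * (\<bar>g x\<bar> / B)) =
          ((A + B) * (1 - t) / A) * \<bar>f x\<bar> + ((A + B) * t / B) * \<bar>g x\<bar>"
        by (simp add: distrib_left)
      also have "\<dots> = \<bar>f x\<bar> + \<bar>g x\<bar>"
        unfolding t(3) using A(1) B(1) pos by (simp add: t_def)
      finally show ?thesis by simp
    qed
    then have "\<bar>f x + g x\<bar> powr p \<le> ((A + B) * ((1 - t) * (\<bar>f x\<bar> / A) + t * (\<bar>g x\<bar> / B))) powr p"
      using p by (intro powr_mono2) auto
    also have "\<dots> = (A + B) powr p * ((1 - t) * (\<bar>f x\<bar> / A) + t * (\<bar>g x\<bar> / B)) powr p"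
      using t A(1) B(1) by (simp add: powr_mult)
    also have "\<dots> \<le> (A + B) powr p * ((1 - t) * (\<bar>f x\<bar> / A) powr p + t * (\<bar>g x\<bar> / B) powr p)"
      using t A(1) B(1) p by (intro mult_left_mono powr_convex_nonneg) auto
    also have "\<dots> = (A + B) powr p *
      ((1 - t) / A powr p * \<bar>f x\<bar> powr p + t / B powr p * \<bar>g x\<bar> powr p)"
      using A(1) B(1) by (simp add: powr_divide)
    finally show ?thesis .
  qed
  have int [simp]: "(\<lambda>x. \<bar>u x\<bar> powr p) integrable_on {a..b}" if "continuous_on {a..b} u" for u :: "real \<Rightarrow> real"
    using that p by (intro integrable_continuous_real continuous_on_abs_powr)
  have lin: "integral {a..b} (\<lambda>x. k * (c * F x + d * G x)) = k * (c * integral {a..b} F + d * integral {a..b} G)"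
    if "F integrable_on {a..b}" "G integrable_on {a..b}" for F G :: "real \<Rightarrow> real" and k c d
    using that by (simp add: integral_add integrable_on_mult_right)
  have "integral {a..b} (\<lambda>x. \<bar>f x + g x\<bar> powr p) \<le> integral {a..b} (\<lambda>x. (A + B) powr p *
      ((1 - t) / A powr p * \<bar>f x\<bar> powr p + t / B powr p * \<bar>g x\<bar> powr p))"
    using f g int[of "\<lambda>x. f x + g x"] pw
    by (intro integral_le integrable_on_mult_right integrable_add int) (auto intro: continuous_intros)
  also have "\<dots> = (A + B) powr p * ((1 - t) / A powr p * integral {a..b} (\<lambda>x. \<bar>f x\<bar> powr p)
      + t / B powr p * integral {a..b} (\<lambda>x. \<bar>g x\<bar> powr p))"
    using lin[OF int[OF f] int[OF g]] .
  also have "\<dots> \<le> (A + B) powr p * ((1 - t) / A powr p * A powr p + t / B powr p * B powr p)"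
    using A B t by (intro mult_left_mono add_mono) auto
  also have "\<dots> = (A + B) powr p" using A(1) B(1) by simp
  finally show ?thesis .
qed

text \<open>This is the \<open>p\<close>-th power of the \<open>L\<^sup>p\<close> norm of an increment. Its integrand is continuous whenever
\<open>g\<close> is, so the Henstock-Kurzweil integral agrees with the Lebesgue integral; it brings simple
rules for translations and subintervals.\<close>
definition incr_int :: "real \<Rightarrow> (real \<Rightarrow> real) \<Rightarrow> real \<Rightarrow> real \<Rightarrow> real \<Rightarrow> real" where
  "incr_int p g h a b = integral {a..b} (\<lambda>x. \<bar>g (x + h) - g x\<bar> powr p)"

lemma continuous_incr:
  fixes g :: "real \<Rightarrow> real"
  assumes "continuous_on UNIV g"
  shows "continuous_on S (\<lambda>x. g (x + h) - g x)"
  by (intro continuous_on_diff continuous_on_compose2[OF assms]) (auto intro!: continuous_intros)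

lemma incr_integrable:
  fixes g :: "real \<Rightarrow> real"
  assumes "1 \<le> p" "continuous_on UNIV g"
  shows "(\<lambda>x. \<bar>g (x + h) - g x\<bar> powr p) integrable_on {a..b}"
  using integrable_continuous_real[OF continuous_on_abs_powr[OF assms(1) continuous_incr[OF assms(2)]]] .

lemma incr_int_nonneg: "0 \<le> incr_int p g h a b"
proof (cases "(\<lambda>x. \<bar>g (x + h) - g x\<bar> powr p) integrable_on {a..b}")
  case True
  then show ?thesis unfolding incr_int_def by (rule Henstock_Kurzweil_Integration.integral_nonneg) auto
qed (simp add: incr_int_def not_integrable_integral)

lemma incr_int_mono:
  assumes "1 \<le> p" "continuous_on UNIV g" "a' \<le> a" "b \<le> b'"
  shows "incr_int p g h a b \<le> incr_int p g h a' b'"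
  unfolding incr_int_def
  using assms by (intro integral_subset_le incr_integrable) auto

lemma incr_int_shift:
  fixes g :: "real \<Rightarrow> real"
  assumes "1 \<le> p" "continuous_on UNIV g"
  shows "integral {a..b} (\<lambda>x. \<bar>g (x + s + h) - g (x + s)\<bar> powr p) = incr_int p g h (a + s) (b + s)"
  using integral_shift[of a s b "\<lambda>x. \<bar>g (x + h) - g x\<bar> powr p",
      OF continuous_on_abs_powr[OF assms(1) continuous_incr[OF assms(2)]]]
  by (simp add: incr_int_def o_def)

text \<open>Subadditivity in the step: the increment over \<open>s + h\<close> is the one over \<open>s\<close> plus the one over
\<open>h\<close> started at \<open>x + s\<close>, which is why the second interval is translated.\<close>
lemma incr_int_add:
  assumes "1 \<le> p" "continuous_on UNIV g"
    and "0 < A" "incr_int p g s a b \<le> A powr p"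
    and "0 < B" "incr_int p g h (a + s) (b + s) \<le> B powr p"
  shows "incr_int p g (s + h) a b \<le> (A + B) powr p"
proof -
  have c: "continuous_on {a..b} (\<lambda>x. g (x + s + h) - g (x + s))"
    by (intro continuous_on_diff continuous_on_compose2[OF assms(2)]) (auto intro!: continuous_intros)
  have "integral {a..b} (\<lambda>x. \<bar>(g (x + s) - g x) + (g (x + s + h) - g (x + s))\<bar> powr p) \<le> (A + B) powr p"
    using assms by (intro minkowski_interval continuous_incr c) (auto simp: incr_int_shift, simp add: incr_int_def)
  then show ?thesis by (simp add: incr_int_def add_ac)
qed


lemma incr_int_minus:
  assumes "1 \<le> p" "continuous_on UNIV g"
  shows "incr_int p g (- h) a b = incr_int p g h (a - h) (b - h)"
proof -
  have "incr_int p g (- h) a b = integral {a..b} (\<lambda>x. \<bar>g (x + - h + h) - g (x + - h)\<bar> powr p)"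
    by (simp add: incr_int_def abs_minus_commute)
  also have "\<dots> = incr_int p g h (a - h) (b - h)"
    by (subst incr_int_shift[OF assms]) simp
  finally show ?thesis .
qed

lemma incr_int_le_add:
  assumes "1 \<le> p" "continuous_on UNIV g"
    and "0 < A" "incr_int p g (s + h) a b \<le> A powr p"
    and "0 < B" "incr_int p g h (a + s) (b + s) \<le> B powr p"
  shows "incr_int p g s a b \<le> (A + B) powr p"
  using incr_int_add[of p g A "s + h" a b B "- h"] assms
  by (simp add: incr_int_minus)

text \<open>Removing the leading binary digit of \<open>d\<close> splits the step \<open>d\<close> into \<open>(1/2) ^ n\<close> and a remainder
below \<open>(1/2) ^ n\<close>. Iteration bounds the norm by a geometric series plus the contribution of the
last remainder, which uniform continuity makes arbitrarily small. The constant
\<open>B = C / (2 powr \<alpha> - 1)\<close> is the sum of the series; it satisfies \<open>C + B = 2 powr \<alpha> * B\<close>, and this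
is what the induction over the digits uses.\<close>
lemma chaining_dyadic:
  fixes g :: "real \<Rightarrow> real"
  assumes p: "1 \<le> p" and g: "continuous_on UNIV g" and al: "0 < \<alpha>" and R: "0 < R"
    and C: "0 < C" and dy: "\<And>n. n0 \<le> n \<Longrightarrow> incr_int p g ((1/2) ^ n) (-R) R \<le> (C * ((1/2) ^ n) powr \<alpha>) powr p"
    and ab: "- R \<le> a" "b + (1/2)^n0 \<le> R" "a \<le> b"
    and d: "0 \<le> d" "d < (1/2)^n0"
  shows "incr_int p g d a b \<le> (C / (2 powr \<alpha> - 1) * ((1/2) ^ n0) powr \<alpha>) powr p"
proof -
  define B where "B = C / (2 powr \<alpha> - 1)"
  have al1: "2 powr \<alpha> > (1::real)" using al by simp
  have B: "B > 0" using C al1 by (simp add: B_def)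
  have Bstep: "(C + B) * ((1/2) ^ Suc n) powr \<alpha> = B * ((1/2) ^ n) powr \<alpha>" for n :: nat
  proof -
    have cancel: "C / x * x = C" if "x \<noteq> 0" for x using that by simp
    have "B * (2 powr \<alpha> - 1) = C" unfolding B_def by (rule cancel) (use al1 in linarith)
    then have "B * (2 powr \<alpha>) = C + B" by (simp add: algebra_simps)
    moreover have "((1/2) ^ n) powr \<alpha> = 2 powr \<alpha> * ((1/2::real) ^ Suc n) powr \<alpha>"
      by (subst powr_mult[symmetric]) auto
    ultimately show ?thesis by (simp add: mult.assoc)
  qed
  have key: "incr_int p g d a b \<le> (B * ((1/2) ^ n0) powr \<alpha> + e) powr p" if e: "0 < e" for e
  proof -
    define e1 where "e1 = e / (2 * R) powr (1/p)"
    have e1: "e1 > 0" "(e1 * (2 * R) powr (1/p)) = e" using e R by (auto simp: e1_def)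
    have "uniformly_continuous_on {-R-1..R+1} g"
      by (rule compact_uniformly_continuous[OF continuous_on_subset[OF g subset_UNIV] compact_Icc])
    then obtain \<rho> where rho: "\<rho> > 0"
      "\<And>x y. x \<in> {-R-1..R+1} \<Longrightarrow> y \<in> {-R-1..R+1} \<Longrightarrow> dist y x < \<rho> \<Longrightarrow> dist (g y) (g x) < e1"
      using e1(1) by (rule uniformly_continuous_onE) blast
    obtain m0 :: nat where m0: "(1/2) ^ m0 < \<rho>"
      using real_arch_pow_inv[OF rho(1), of "1/2"] by auto
    define m where "m = n0 + m0"
    have m: "n0 \<le> m" "(1/2) ^ m < \<rho>"
      using le_less_trans[OF power_decreasing[of m0 m "1/2::real"] m0] by (auto simp: m_def)
    \<comment> \<open>Induction on the number \<open>k\<close> of digits left before the step falls below the modulus of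
        uniform continuity \<open>(1/2) ^ m\<close>.\<close>
    have ind: "incr_int p g d a b \<le> (B * ((1/2) ^ n) powr \<alpha> + e) powr p"
      if "n + k = m" "n0 \<le> n" "0 \<le> d" "d < (1/2) ^ n" "-R \<le> a" "b + (1/2)^n \<le> R" "a \<le> b" for n k d a b
      using that
    proof (induction k arbitrary: n d a b)
      case 0
      have pw: "\<bar>g (x + d) - g x\<bar> powr p \<le> e1 powr p" if "x \<in> {a..b}" for x
      proof -
        have le1: "(1/2::real)^n \<le> 1" by (simp add: power_le_one)
        have "dist (g (x + d)) (g x) < e1"
        proof (rule rho(2))
          show "x \<in> {-R-1..R+1}" "x + d \<in> {-R-1..R+1}"
            using that 0 le1 zero_le_power[of "1/2::real" n] by auto
          show "dist (x + d) x < \<rho>" using 0 m by (simp add: dist_real_def)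
        qed
        then show ?thesis using p by (intro powr_mono2) (auto simp: dist_real_def)
      qed
      have "incr_int p g d a b \<le> integral {a..b} (\<lambda>x. e1 powr p)"
        unfolding incr_int_def using p g pw by (intro integral_le incr_integrable) auto
      also have "\<dots> = (b - a) * e1 powr p" using 0 by simp
      also have "\<dots> \<le> (2 * R) * e1 powr p"
        using 0 zero_le_power[of "1/2::real" n] by (intro mult_right_mono) auto
      also have "\<dots> = e powr p"
      proof -
        have "e powr p = (e1 * (2 * R) powr (1/p)) powr p" by (simp only: e1(2))
        also have "\<dots> = e1 powr p * ((2 * R) powr (1/p)) powr p" using e1(1) by (simp add: powr_mult)
        also have "((2 * R) powr (1/p)) powr p = 2 * R" using R p by (simp add: powr_powr)
        finally show ?thesis by simp
      qed
      also have "\<dots> \<le> (B * ((1/2) ^ n) powr \<alpha> + e) powr p"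
        using B p e by (intro powr_mono2) auto
      finally show ?case .
    next
      case (Suc k)
      \<comment> \<open>The digit of weight \<open>t\<close> is 0 or 1 according to whether \<open>d < t\<close>.\<close>
      define t :: real where "t = (1/2) ^ Suc n"
      have half: "(1/2::real) ^ n = t + t" by (simp add: t_def)
      have pos: "0 < t" by (simp add: t_def)
      note IH = Suc.IH[of "Suc n", folded t_def]
      have n: "Suc n + k = m" "n0 \<le> Suc n" using Suc.prems by auto
      show ?case
      proof (cases "d < t")
        case True
        have "incr_int p g d a b \<le> (B * t powr \<alpha> + e) powr p"
          using Suc.prems(3-) True half pos by (intro IH n) linarith+
        also have "\<dots> \<le> (B * ((1/2) ^ n) powr \<alpha> + e) powr p"
          unfolding half using B p e al pos by (intro powr_mono2 add_mono mult_left_mono) auto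
        finally show ?thesis .
      next
        case False
        have 1: "incr_int p g t a b \<le> (C * t powr \<alpha>) powr p"
        proof (rule order_trans[OF incr_int_mono[OF p g]])
          show "-R \<le> a" "b \<le> R" using Suc.prems half pos by linarith+
          show "incr_int p g t (-R) R \<le> (C * t powr \<alpha>) powr p"
            unfolding t_def using n by (intro dy)
        qed
        have 2: "incr_int p g (d - t) (a + t) (b + t)
            \<le> (B * t powr \<alpha> + e) powr p"
          using Suc.prems(3-) False half pos by (intro IH n) linarith+
        have "incr_int p g (t + (d - t)) a b
            \<le> (C * t powr \<alpha> + (B * t powr \<alpha> + e)) powr p"
          using B C e pos by (intro incr_int_add[OF p g _ 1 _ 2] add_nonneg_pos) auto
        also have "C * t powr \<alpha> + (B * t powr \<alpha> + e) = B * ((1/2) ^ n) powr \<alpha> + e"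
          using Bstep[of n] unfolding t_def[symmetric] by (simp add: distrib_right)
        finally show ?thesis by simp
      qed
    qed
    show ?thesis using ind[of n0 "m - n0"] ab d m by simp
  qed
  have "((\<lambda>e. (B * ((1/2) ^ n0) powr \<alpha> + e) powr p) \<longlongrightarrow> (B * ((1/2) ^ n0) powr \<alpha> + 0) powr p) (at_right 0)"
    using B by (intro tendsto_intros) auto
  then have "incr_int p g d a b \<le> (B * ((1/2) ^ n0) powr \<alpha> + 0) powr p"
  proof (rule tendsto_lowerbound)
    show "eventually (\<lambda>e. incr_int p g d a b \<le> (B * ((1/2) ^ n0) powr \<alpha> + e) powr p) (at_right 0)"
      using eventually_at_right_less by (rule eventually_mono) (rule key)
  qed simp
  then show ?thesis by (simp add: B_def)
qed

section \<open>From geometric sequences of steps to all steps\<close>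

lemma geometric_bracket:
  fixes q h :: real
  assumes q: "0 < q" "q < 1" and h: "0 < h" "h < q ^ N"
  obtains n where "N \<le> n" "q ^ Suc n \<le> h" "h < q ^ n"
proof -
  define k where "k = (LEAST k. q ^ k \<le> h)"
  have ex: "\<exists>k. q ^ k \<le> h"
    using real_arch_pow_inv[OF h(1) q(2)] by (auto intro: less_imp_le)
  have k: "q ^ k \<le> h" unfolding k_def by (rule LeastI_ex[OF ex])
  have nk: "h < q ^ j" if "j < k" for j
    using not_less_Least[of j "\<lambda>k. q ^ k \<le> h"] that by (auto simp: k_def)
  have "N < k"
  proof (rule ccontr)
    assume "\<not> N < k"
    then have "q ^ N \<le> q ^ k" using q by (intro power_decreasing) auto
    then show False using k h by simp
  qed
  then have "N \<le> k - 1" "Suc (k - 1) = k" by auto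
  then show ?thesis using that[of "k - 1"] k nk[of "k - 1"] by simp
qed

text \<open>A step \<open>d\<close> between two consecutive powers of 1/2 inherits the chaining bound of the larger
one, at the cost of a factor \<open>2 powr \<alpha>\<close>. The interval stays away from the end of \<open>[-R, R]\<close> by 1
to leave room for the translations.\<close>
lemma incr_int_le_powr:
  fixes g :: "real \<Rightarrow> real"
  assumes p: "1 \<le> p" and g: "continuous_on UNIV g" and al: "0 < \<alpha>" and R: "0 < R"
    and lim: "(\<lambda>n. incr_int p g ((1/2) ^ n) (-R) R / ((1/2) ^ n) powr (\<alpha> * p)) \<longlonglongrightarrow> l"
  obtains K \<delta> where "0 < K" "0 < \<delta>"
    "\<And>d a b. 0 < d \<Longrightarrow> d < \<delta> \<Longrightarrow> - R \<le> a \<Longrightarrow> a \<le> b \<Longrightarrow> b + 1 \<le> R \<Longrightarrow> incr_int p g d a b \<le> (K * d powr \<alpha>) powr p"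
proof -
  have "Bseq (\<lambda>n. incr_int p g ((1/2) ^ n) (-R) R / ((1/2) ^ n) powr (\<alpha> * p))"
    using lim by (intro convergent_imp_Bseq convergentI)
  then obtain D where D: "0 < D" "\<And>n. incr_int p g ((1/2) ^ n) (-R) R / ((1/2) ^ n) powr (\<alpha> * p) \<le> D"
    unfolding Bseq_def real_norm_def by (meson abs_le_D1)
  define C where "C = D powr (1/p)"
  have C: "0 < C" using D(1) by (simp add: C_def)
  have dy: "incr_int p g ((1/2) ^ n) (-R) R \<le> (C * ((1/2) ^ n) powr \<alpha>) powr p" for n
    using D(2)[of n] D(1) p by (simp add: C_def powr_mult powr_powr divide_le_eq)
  define K where "K = C / (2 powr \<alpha> - 1) * 2 powr \<alpha>"
  have al1: "2 powr \<alpha> > (1::real)" using al by simp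
  have K: "K > 0" using C al1 by (simp add: K_def)
  show ?thesis
  proof (rule that[OF K, of 1])
    fix d a b :: real assume d: "0 < d" "d < 1" and ab: "-R \<le> a" "a \<le> b" "b + 1 \<le> R"
    obtain n where n: "(1/2) ^ Suc n \<le> d" "d < (1/2) ^ n"
      using geometric_bracket[of "1/2" d 0] d by auto
    have le1: "(1/2::real)^n \<le> 1" by (simp add: power_le_one)
    have "incr_int p g d a b \<le> (C / (2 powr \<alpha> - 1) * ((1/2) ^ n) powr \<alpha>) powr p"
      using ab d n le1 C by (intro chaining_dyadic[OF p g al R C dy]) auto
    also have "\<dots> \<le> (K * d powr \<alpha>) powr p"
    proof -
      have "((1/2) ^ n) powr \<alpha> \<le> (2 * d) powr \<alpha>"
        using n al by (intro powr_mono2) auto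
      then have "C / (2 powr \<alpha> - 1) * ((1/2) ^ n) powr \<alpha> \<le> C / (2 powr \<alpha> - 1) * (2 * d) powr \<alpha>"
        using C al1 by (intro mult_left_mono) auto
      then show ?thesis using C al1 p d by (intro powr_mono2) (auto simp: K_def powr_mult mult.assoc)
    qed
    finally show "incr_int p g d a b \<le> (K * d powr \<alpha>) powr p" .
  qed simp
qed

text \<open>Let \<open>u(h)\<close> be the normalized norm. With \<open>q = (m + 1) / (m + 2)\<close> every small \<open>h\<close> is \<open>k + d\<close>, where
\<open>k\<close> is a power of \<open>q\<close> and \<open>0 \<le> d \<le> k / (m + 1)\<close>. Apart from the change of normalization, whose
ratio tends to 1, the step \<open>d\<close> changes \<open>u\<close> by at most a constant times
\<open>(1 / (m + 1)) powr \<alpha>\<close>, in both directions by the triangle inequality, so \<open>u(h)\<close> is close to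
\<open>u(k)\<close>, hence to its limit, once \<open>m\<close> is large.\<close>
lemma limit_from_geometric:
  fixes g :: "real \<Rightarrow> real"
  assumes p: "1 \<le> p" and g: "continuous_on UNIV g" and al: "0 < \<alpha>" and ab: "a \<le> b" and l: "0 \<le> l"
    and R: "0 < R" "-R \<le> a" "b + 2 \<le> R"
    and dya: "(\<lambda>n. incr_int p g ((1/2) ^ n) (-R) R / ((1/2) ^ n) powr (\<alpha> * p)) \<longlonglongrightarrow> l'"
    and geo: "\<And>m. (\<lambda>n. incr_int p g ((real (Suc m) / real (m + 2)) ^ n) a b
                       / ((real (Suc m) / real (m + 2)) ^ n) powr (\<alpha> * p)) \<longlonglongrightarrow> l"
  shows "((\<lambda>h. incr_int p g h a b / h powr (\<alpha> * p)) \<longlongrightarrow> l) (at_right 0)"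
proof -
  define L where "L = l powr (1/p)"
  have L: "0 \<le> L" "L powr p = l" using p l by (auto simp: L_def powr_powr)
  obtain K \<delta> where K: "0 < K" and del: "0 < \<delta>" and chain:
    "\<And>d a b. 0 < d \<Longrightarrow> d < \<delta> \<Longrightarrow> - R \<le> a \<Longrightarrow> a \<le> b \<Longrightarrow> b + 1 \<le> R \<Longrightarrow> incr_int p g d a b \<le> (K * d powr \<alpha>) powr p"
    using incr_int_le_powr[OF p g al R(1) dya] by blast
  define u where "u = (\<lambda>h. (incr_int p g h a b / h powr (\<alpha> * p)) powr (1/p))"
  have u_nn: "0 \<le> u h" for h by (simp add: u_def)
  have u_le: "incr_int p g h a b \<le> (A * h powr \<alpha>) powr p" if "0 < h" "0 \<le> A" "u h \<le> A" for h A
  proof -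
    have "u h powr p \<le> A powr p" using that p u_nn by (intro powr_mono2) auto
    then show ?thesis using that p incr_int_nonneg[of p g h a b]
      by (simp add: u_def powr_powr powr_mult divide_le_eq)
  qed
  have le_u: "u h \<le> A" if "0 < h" "0 \<le> A" "incr_int p g h a b \<le> (A * h powr \<alpha>) powr p" for h A
  proof -
    have "incr_int p g h a b / h powr (\<alpha> * p) \<le> A powr p"
      using that by (simp add: powr_powr powr_mult divide_le_eq)
    then have "u h \<le> (A powr p) powr (1/p)"
      unfolding u_def using p incr_int_nonneg[of p g h a b] by (intro powr_mono2) auto
    then show ?thesis using that p by (simp add: powr_powr)
  qed
  have close: "eventually (\<lambda>h. L - 3 * e \<le> u h \<and> u h \<le> L + 2 * e) (at_right 0)" if e: "0 < e" for e
  proof -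
    have "(\<lambda>m. L * (1 + inverse (real (Suc m))) powr \<alpha>) \<longlonglongrightarrow> L * (1 + 0) powr \<alpha>"
      by (intro tendsto_intros LIMSEQ_inverse_real_of_nat) auto
    then have "eventually (\<lambda>m. L * (1 + inverse (real (Suc m))) powr \<alpha> < L + e) sequentially"
      using e by (intro order_tendstoD) auto
    moreover have "(\<lambda>m. K * inverse (real (Suc m)) powr \<alpha>) \<longlonglongrightarrow> K * 0"
      using al by (intro tendsto_intros tendsto_zero_powrI[where b=\<alpha>] LIMSEQ_inverse_real_of_nat) auto
    then have "eventually (\<lambda>m. K * inverse (real (Suc m)) powr \<alpha> < e) sequentially"
      using e by (intro order_tendstoD) auto
    \<comment> \<open>The first bound absorbs the ratio of the normalizations at \<open>h\<close> and \<open>k\<close>, the second one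
        the increment over the remaining step.\<close>
    ultimately obtain m where m: "L * (1 + inverse (real (Suc m))) powr \<alpha> < L + e"
        "K * inverse (real (Suc m)) powr \<alpha> < e"
      by (metis (mono_tags, lifting) eventually_conj eventually_sequentially order_refl)
    define q where "q = real (Suc m) / real (m + 2)"
    have q: "0 < q" "q < 1" "inverse q = 1 + inverse (real (Suc m))" by (auto simp: q_def field_simps)
    have "(\<lambda>n. u (q ^ n)) \<longlonglongrightarrow> L"
      unfolding u_def L_def q_def using p incr_int_nonneg
      by (intro tendsto_powr' geo tendsto_const) auto
    then have "eventually (\<lambda>n. u (q ^ n) < L + e \<and> L - e < u (q ^ n)) sequentially"
      using e by (intro eventually_conj order_tendstoD) auto
    then obtain N where N: "\<And>n. N \<le> n \<Longrightarrow> u (q ^ n) < L + e \<and> L - e < u (q ^ n)"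
      by (auto simp: eventually_sequentially)
    have "L - 3 * e \<le> u h \<and> u h \<le> L + 2 * e" if h: "0 < h" "h < min (q ^ N) (min \<delta> 1)" for h
    proof -
      obtain n where n: "N \<le> n" "q ^ Suc n \<le> h" "h < q ^ n"
        using geometric_bracket[of q h N] q h by auto
      define k where "k = q ^ Suc n"
      have k: "0 < k" "k \<le> h" "h \<le> k * (1 + inverse (real (Suc m)))"
      proof -
        show "0 < k" "k \<le> h" using q n by (auto simp: k_def)
        have "k * (1 + inverse (real (Suc m))) = q ^ n"
          unfolding k_def q(3)[symmetric] using q(1) by simp
        then show "h \<le> k * (1 + inverse (real (Suc m)))" using n by simp
      qed
      have uk: "u k < L + e" "L - e < u k" using N[of "Suc n"] n by (auto simp: k_def)
      \<comment> \<open>The increment over the remaining step \<open>h - k\<close> is negligible.\<close>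
      have rest: "incr_int p g (h - k) (a + k) (b + k) \<le> (e * k powr \<alpha>) powr p"
      proof (cases "h = k")
        case True
        then show ?thesis using p by (simp add: incr_int_def)
      next
        case False
        have "incr_int p g (h - k) (a + k) (b + k) \<le> (K * (h - k) powr \<alpha>) powr p"
          using False k h R ab by (intro chain) auto
        also have "\<dots> \<le> (K * (k * inverse (real (Suc m))) powr \<alpha>) powr p"
          using k K p al by (intro powr_mono2 mult_left_mono) (auto simp: algebra_simps)
        also have "\<dots> = (K * inverse (real (Suc m)) powr \<alpha> * k powr \<alpha>) powr p"
          using k by (simp add: powr_mult mult_ac)
        also have "\<dots> \<le> (e * k powr \<alpha>) powr p"
          using m K p by (intro powr_mono2 mult_right_mono) auto
        finally show ?thesis .
      qed
      have kh: "k powr \<alpha> \<le> h powr \<alpha>" using k al by (intro powr_mono2) auto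
      have hk: "h powr \<alpha> \<le> k powr \<alpha> * (1 + inverse (real (Suc m))) powr \<alpha>"
        using k h al by (subst powr_mult[symmetric]) (auto intro!: powr_mono2)
      have ek: "0 < e * k powr \<alpha>" using e k by simp
      have "u h \<le> L + 2 * e"
      proof (rule le_u)
        have "incr_int p g (k + (h - k)) a b \<le> ((L + e) * k powr \<alpha> + e * k powr \<alpha>) powr p"
          using uk k L e ek rest by (intro incr_int_add[OF p g] u_le) auto
        also have "\<dots> = ((L + 2 * e) * k powr \<alpha>) powr p" by (simp add: algebra_simps)
        also have "\<dots> \<le> ((L + 2 * e) * h powr \<alpha>) powr p"
          using p L e kh by (intro kh powr_mono2 mult_left_mono) auto
        finally show "incr_int p g h a b \<le> ((L + 2 * e) * h powr \<alpha>) powr p" by simp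
      qed (use h L e in auto)
      moreover have "L - 3 * e \<le> u h"
      proof (rule ccontr)
        assume "\<not> L - 3 * e \<le> u h"
        then have *: "u h \<le> L - 3 * e" by simp
        have pos: "0 \<le> L - 3 * e" using * u_nn[of h] by linarith
        have Lp: "0 < L" using pos e by simp
        have "incr_int p g h a b \<le> ((L - 2 * e) * k powr \<alpha>) powr p"
        proof (rule order_trans[OF u_le[OF h(1) pos *]])
          have "(L - 3 * e) * h powr \<alpha> \<le> (L - 3 * e) * (k powr \<alpha> * (1 + inverse (real (Suc m))) powr \<alpha>)"
            using hk pos by (intro mult_left_mono)
          also have "\<dots> = ((L - 3 * e) * (1 + inverse (real (Suc m))) powr \<alpha>) * k powr \<alpha>" by simp
          also have "\<dots> \<le> (L - 2 * e) * k powr \<alpha>"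
          proof (rule mult_right_mono)
            have "1 \<le> (1 + inverse (real (Suc m))) powr \<alpha>" using al by (intro ge_one_powr_ge_zero) auto
            then have "3 * e \<le> 3 * e * (1 + inverse (real (Suc m))) powr \<alpha>" using e by simp
            then show "(L - 3 * e) * (1 + inverse (real (Suc m))) powr \<alpha> \<le> L - 2 * e"
              using m(1) by (simp add: left_diff_distrib)
          qed simp
          finally show "((L - 3 * e) * h powr \<alpha>) powr p \<le> ((L - 2 * e) * k powr \<alpha>) powr p"
            using p pos by (intro powr_mono2) auto
        qed
        then have "incr_int p g k a b \<le> ((L - 2 * e) * k powr \<alpha> + e * k powr \<alpha>) powr p"
          using rest ek pos e k by (intro incr_int_le_add[OF p g, of _ k "h - k"]) auto
        then have "u k \<le> L - e"
          using pos e k by (intro le_u) (auto simp: algebra_simps)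
        then show False using uk by simp
      qed
      ultimately show ?thesis by simp
    qed
    then show ?thesis
      using q del by (intro eventually_at_rightI[of 0 "min (q ^ N) (min \<delta> 1)"]) auto
  qed
  have "(u \<longlongrightarrow> L) (at_right 0)"
  proof (rule tendstoI)
    fix e :: real assume "0 < e"
    then have "eventually (\<lambda>h. L - 3 * (e / 4) \<le> u h \<and> u h \<le> L + 2 * (e / 4)) (at_right 0)"
      by (intro close) auto
    then show "eventually (\<lambda>h. dist (u h) L < e) (at_right 0)"
      by eventually_elim (use \<open>0 < e\<close> in \<open>auto simp: dist_real_def abs_less_iff\<close>)
  qed
  then have "((\<lambda>h. u h powr p) \<longlongrightarrow> L powr p) (at_right 0)"
    using p u_nn by (intro tendsto_powr' tendsto_const) auto
  moreover have "u h powr p = incr_int p g h a b / h powr (\<alpha> * p)" for h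
    using p incr_int_nonneg[of p g h a b] by (simp add: u_def powr_powr)
  ultimately show ?thesis using L by simp
qed

text \<open>The integral is monotone in the interval, so rational intervals slightly larger and slightly
smaller than \<open>[a, b]\<close> enclose it. The same enclosure absorbs the translation by \<open>h\<close> that turns a
negative step into a positive one.\<close>
lemma limit_from_rational_intervals:
  fixes g :: "real \<Rightarrow> real"
  assumes p: "1 \<le> p" and g: "continuous_on UNIV g" and c: "0 \<le> c" and ab: "a < b"
    and lim: "\<And>a b. a \<in> \<rat> \<Longrightarrow> b \<in> \<rat> \<Longrightarrow> a < b \<Longrightarrow>
      ((\<lambda>h. incr_int p g h a b / h powr \<beta>) \<longlongrightarrow> c * (b - a)) (at_right 0)"
  shows "((\<lambda>h. incr_int p g h a b / \<bar>h\<bar> powr \<beta>) \<longlongrightarrow> c * (b - a)) (at 0)"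
proof -
  have abs0: "filterlim (\<lambda>h::real. \<bar>h\<bar>) (at_right 0) (at 0)"
    unfolding filterlim_at
    by (auto intro!: tendsto_eq_intros simp: eventually_at_filter)
  \<comment> \<open>A step \<open>h < 0\<close> is a step \<open>\<bar>h\<bar>\<close> on the interval translated by \<open>h\<close>.\<close>
  have move: "\<exists>s. \<bar>s\<bar> \<le> \<bar>h\<bar> \<and> incr_int p g h a b = incr_int p g \<bar>h\<bar> (a + s) (b + s)" for h
  proof (cases "0 \<le> h")
    case True then show ?thesis by (intro exI[of _ 0]) auto
  next
    case False then show ?thesis
      using incr_int_minus[OF p g, of "-h" a b] by (intro exI[of _ h]) auto
  qed
  show ?thesis
  proof (rule order_tendstoI)
    fix y assume y: "c * (b - a) < y"
    \<comment> \<open>Enlarging \<open>[a, b]\<close> by \<open>\<eta>\<close> on both sides must keep the limit below \<open>y\<close>.\<close>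
    define \<eta> where "\<eta> = (y - c * (b - a)) / (2 * c + 1)"
    have eta: "0 < \<eta>" using y c by (simp add: \<eta>_def)
    have "\<eta> * (2 * c + 1) = y - c * (b - a)" using c by (simp add: \<eta>_def)
    then have eta2: "c * (2 * \<eta>) + \<eta> = y - c * (b - a)" by (simp add: algebra_simps)
    obtain a1 b1 where a1: "a1 \<in> \<rat>" "a - \<eta> < a1" "a1 < a" and b1: "b1 \<in> \<rat>" "b < b1" "b1 < b + \<eta>"
      using Rats_dense_in_real[of "a - \<eta>" a] Rats_dense_in_real[of b "b + \<eta>"] eta by auto
    have "c * (b1 - a1) \<le> c * (b - a + 2 * \<eta>)" using a1 b1 c by (intro mult_left_mono) auto
    also have "\<dots> < y" using eta2 eta by (simp add: algebra_simps)
    finally have "eventually (\<lambda>h. incr_int p g h a1 b1 / h powr \<beta> < y) (at_right 0)"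
      using a1 b1 ab by (intro order_tendstoD(2)[OF lim]) auto
    then have "eventually (\<lambda>h. incr_int p g \<bar>h\<bar> a1 b1 / \<bar>h\<bar> powr \<beta> < y) (at 0)"
      by (rule filterlim_iff[THEN iffD1, OF abs0, rule_format])
    moreover have "eventually (\<lambda>h::real. dist h 0 < min (a - a1) (b1 - b)) (at 0)"
      unfolding eventually_at using a1 b1 by (intro exI[of _ "min (a - a1) (b1 - b)"]) auto
    ultimately show "eventually (\<lambda>h. incr_int p g h a b / \<bar>h\<bar> powr \<beta> < y) (at 0)"
    proof eventually_elim
      case (elim h)
      obtain s where s: "\<bar>s\<bar> \<le> \<bar>h\<bar>" "incr_int p g h a b = incr_int p g \<bar>h\<bar> (a + s) (b + s)"
        using move by blast
      have "incr_int p g h a b \<le> incr_int p g \<bar>h\<bar> a1 b1"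
        unfolding s(2) using s(1) elim(2) by (intro incr_int_mono[OF p g]) (auto simp: dist_real_def)
      then have "incr_int p g h a b / \<bar>h\<bar> powr \<beta> \<le> incr_int p g \<bar>h\<bar> a1 b1 / \<bar>h\<bar> powr \<beta>"
        by (intro divide_right_mono) auto
      then show ?case using elim(1) by simp
    qed
  next
    fix y assume y: "y < c * (b - a)"
    define \<eta> where "\<eta> = min ((c * (b - a) - y) / (2 * c + 1)) ((b - a) / 2)"
    have c1: "0 < 2 * c + 1" using c by linarith
    have eta0: "0 < (c * (b - a) - y) / (2 * c + 1)" using y c by (intro divide_pos_pos) auto
    have eta: "0 < \<eta>" "\<eta> \<le> (b - a) / 2"
      unfolding \<eta>_def min_less_iff_conj by (intro conjI eta0, use ab in simp, rule min.cobounded2)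
    have "\<eta> * (2 * c + 1) \<le> c * (b - a) - y"
      unfolding pos_le_divide_eq[symmetric, OF c1] by (simp add: \<eta>_def)
    then have eta2: "c * (2 * \<eta>) + \<eta> \<le> c * (b - a) - y" by (simp add: algebra_simps)
    obtain a1 b1 where a1: "a1 \<in> \<rat>" "a < a1" "a1 < a + \<eta>" and b1: "b1 \<in> \<rat>" "b - \<eta> < b1" "b1 < b"
      using Rats_dense_in_real[of a "a + \<eta>"] Rats_dense_in_real[of "b - \<eta>" b] eta by auto
    have ab1: "a1 < b1" using a1 b1 eta by (simp add: field_simps)
    have "y < c * (b - a - 2 * \<eta>)" using eta2 eta by (simp add: algebra_simps)
    also have "\<dots> \<le> c * (b1 - a1)" using a1 b1 c by (intro mult_left_mono) auto
    finally have "eventually (\<lambda>h. y < incr_int p g h a1 b1 / h powr \<beta>) (at_right 0)"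
      using a1 b1 ab1 by (intro order_tendstoD(1)[OF lim]) auto
    then have "eventually (\<lambda>h. y < incr_int p g \<bar>h\<bar> a1 b1 / \<bar>h\<bar> powr \<beta>) (at 0)"
      by (rule filterlim_iff[THEN iffD1, OF abs0, rule_format])
    moreover have "eventually (\<lambda>h::real. dist h 0 < min (a1 - a) (b - b1)) (at 0)"
      unfolding eventually_at using a1 b1 by (intro exI[of _ "min (a1 - a) (b - b1)"]) auto
    ultimately show "eventually (\<lambda>h. y < incr_int p g h a b / \<bar>h\<bar> powr \<beta>) (at 0)"
    proof eventually_elim
      case (elim h)
      obtain s where s: "\<bar>s\<bar> \<le> \<bar>h\<bar>" "incr_int p g h a b = incr_int p g \<bar>h\<bar> (a + s) (b + s)"
        using move by blast
      have "incr_int p g \<bar>h\<bar> a1 b1 \<le> incr_int p g h a b"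
        unfolding s(2) using s(1) elim(2) by (intro incr_int_mono[OF p g]) (auto simp: dist_real_def)
      then have "incr_int p g \<bar>h\<bar> a1 b1 / \<bar>h\<bar> powr \<beta> \<le> incr_int p g h a b / \<bar>h\<bar> powr \<beta>"
        by (intro divide_right_mono) auto
      then show ?case using elim(1) by simp
    qed
  qed
qed

section \<open>Functions of correlated Gaussian variables\<close>

lemma integral_std_normal_cos:
  "integrable lborel (\<lambda>x. std_normal_density x * cos (t * x))"
  "(\<integral>x. std_normal_density x * cos (t * x) \<partial>lborel) = exp (- t\<^sup>2 / 2)"
proof -
  interpret real_distribution std_normal_distribution by (rule real_dist_normal_dist)
  have int: "complex_integrable std_normal_distribution (\<lambda>x. iexp (t * x))"
    by (rule integrable_iexp) auto
  have "exp (- t\<^sup>2 / 2) = Re (char std_normal_distribution t)"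
    by (simp add: char_std_normal_distribution)
  also have "\<dots> = (\<integral>x. Re (iexp (t * x)) \<partial>std_normal_distribution)"
    unfolding char_def by (rule integral_Re[OF int, symmetric])
  also have "(\<lambda>x. Re (iexp (t * x))) = (\<lambda>x. cos (t * x))"
    by (simp add: Re_exp)
  also have "(\<integral>x. cos (t * x) \<partial>std_normal_distribution) = (\<integral>x. std_normal_density x * cos (t * x) \<partial>lborel)"
    by (subst integral_density) auto
  finally show "(\<integral>x. std_normal_density x * cos (t * x) \<partial>lborel) = exp (- t\<^sup>2 / 2)" ..
  have "integrable std_normal_distribution (\<lambda>x. cos (t * x))"
    by (intro integrable_const_bound[of _ 1]) auto
  then show "integrable lborel (\<lambda>x. std_normal_density x * cos (t * x))"
    by (subst (asm) integrable_density) auto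
qed

lemma integral_std_normal_exp:
  "integrable lborel (\<lambda>x. std_normal_density x * exp (t * x))"
  "(\<integral>x. std_normal_density x * exp (t * x) \<partial>lborel) = exp (t\<^sup>2 / 2)"
proof -
  \<comment> \<open>Completing the square in the exponent.\<close>
  have *: "std_normal_density x * exp (t * x) = exp (t\<^sup>2 / 2) * normal_density t 1 x" for x
    unfolding normal_density_def
    by (simp add: exp_add[symmetric] mult_ac power2_eq_square)
       (simp add: field_simps)
  show "integrable lborel (\<lambda>x. std_normal_density x * exp (t * x))"
    "(\<integral>x. std_normal_density x * exp (t * x) \<partial>lborel) = exp (t\<^sup>2 / 2)"
    unfolding * by simp_all
qed

lemma integral_std_normal_cosh:
  "integrable lborel (\<lambda>x. std_normal_density x * cosh (t * x))"
  "(\<integral>x. std_normal_density x * cosh (t * x) \<partial>lborel) = exp (t\<^sup>2 / 2)"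
proof -
  have *: "std_normal_density x * cosh (t * x) =
      (std_normal_density x * exp (t * x) + std_normal_density x * exp ((- t) * x)) / 2" for x
    by (simp add: cosh_def algebra_simps)
  show "integrable lborel (\<lambda>x. std_normal_density x * cosh (t * x))"
    unfolding * using integral_std_normal_exp(1)[of t] integral_std_normal_exp(1)[of "-t"] by simp
  show "(\<integral>x. std_normal_density x * cosh (t * x) \<partial>lborel) = exp (t\<^sup>2 / 2)"
    unfolding * using integral_std_normal_exp[of t] integral_std_normal_exp[of "-t"] by simp
qed

lemma gaussian_rv_cases:
  assumes "prob_space M" "gaussian_rv M X"
    and "prob_space.expectation M X = 0" "prob_space.expectation M (\<lambda>\<omega>. (X \<omega>)\<^sup>2) = v"
  obtains "v > 0" "distributed M lborel (\<lambda>\<omega>. X \<omega> / sqrt v) std_normal_density" | "v = 0" "AE \<omega> in M. X \<omega> = 0"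
proof -
  interpret prob_space M by fact
  from assms(2) have [measurable]: "X \<in> borel_measurable M" by (simp add: gaussian_rv_def)
  from assms(2) consider \<mu> s where "s > 0" "distributed M lborel X (normal_density \<mu> s)" | \<mu> where "AE \<omega> in M. X \<omega> = \<mu>"
    by (auto simp: gaussian_rv_def)
  then show thesis
  proof cases
    case 1
    have "\<mu> = 0" using normal_distributed_expectation[OF 1] assms(3) by simp
    moreover have "v = s\<^sup>2" using normal_distributed_variance[OF 1] assms(3,4) by simp
    ultimately show thesis using that(1) 1 normal_standard_normal_convert[of s X \<mu>] by simp
  next
    case 2
    have "expectation X = expectation (\<lambda>_. \<mu>)" using 2 by (intro integral_cong_AE) auto
    then have mu: "\<mu> = 0" using assms(3) by (simp add: prob_space)
    have "expectation (\<lambda>\<omega>. (X \<omega>)\<^sup>2) = expectation (\<lambda>_. 0)" using 2 mu by (intro integral_cong_AE) auto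
    then show thesis using that(2) 2 mu assms(4) by simp
  qed
qed

text \<open>A centred Gaussian variable with variance \<open>v\<close> has the law of \<open>sqrt v\<close> times a standard normal
variable. This form covers the degenerate case \<open>v = 0\<close>, which does occur for sums and
differences of fully correlated variables.\<close>
lemma gaussian_rv_transfer:
  assumes "prob_space M" "gaussian_rv M X"
    and "prob_space.expectation M X = 0" "prob_space.expectation M (\<lambda>\<omega>. (X \<omega>)\<^sup>2) = v"
    and f [measurable]: "f \<in> borel_measurable borel"
    and int: "integrable lborel (\<lambda>x. std_normal_density x * f (sqrt v * x))"
  shows "integrable M (\<lambda>\<omega>. f (X \<omega>) :: real)"
    and "prob_space.expectation M (\<lambda>\<omega>. f (X \<omega>)) = (\<integral>x. std_normal_density x * f (sqrt v * x) \<partial>lborel)"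
proof -
  interpret prob_space M by fact
  from assms(2) have [measurable]: "X \<in> borel_measurable M" by (simp add: gaussian_rv_def)
  have "integrable M (\<lambda>\<omega>. f (X \<omega>)) \<and> expectation (\<lambda>\<omega>. f (X \<omega>)) = (\<integral>x. std_normal_density x * f (sqrt v * x) \<partial>lborel)"
    using assms(1-4)
  proof (cases rule: gaussian_rv_cases)
    case 1
    have "integrable M (\<lambda>\<omega>. f (sqrt v * (X \<omega> / sqrt v)))"
      using distributed_integrable[OF 1(2), of "\<lambda>x. f (sqrt v * x)"] int by auto
    moreover have "expectation (\<lambda>\<omega>. f (sqrt v * (X \<omega> / sqrt v))) = (\<integral>x. std_normal_density x * f (sqrt v * x) \<partial>lborel)"
      using distributed_integral[OF 1(2), of "\<lambda>x. f (sqrt v * x)"] by auto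
    ultimately show ?thesis using 1(1) by simp
  next
    case 2
    have "integrable M (\<lambda>\<omega>. f (X \<omega>)) \<longleftrightarrow> integrable M (\<lambda>\<omega>. f 0)" using 2 by (intro integrable_cong_AE) auto
    moreover have "expectation (\<lambda>\<omega>. f (X \<omega>)) = expectation (\<lambda>\<omega>. f 0)" using 2 by (intro integral_cong_AE) auto
    ultimately show ?thesis using 2(1) by (simp add: prob_space)
  qed
  then show "integrable M (\<lambda>\<omega>. f (X \<omega>))"
    "expectation (\<lambda>\<omega>. f (X \<omega>)) = (\<integral>x. std_normal_density x * f (sqrt v * x) \<partial>lborel)" by auto
qed

lemma gaussian_rv_integrable:
  assumes "prob_space M" "gaussian_rv M X"
  shows "integrable M X" "integrable M (\<lambda>\<omega>. (X \<omega>)\<^sup>2)"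
proof -
  interpret prob_space M by fact
  from assms(2) have [measurable]: "X \<in> borel_measurable M" by (simp add: gaussian_rv_def)
  from assms(2) consider \<mu> s where "s > 0" "distributed M lborel X (normal_density \<mu> s)" | \<mu> where "AE \<omega> in M. X \<omega> = \<mu>"
    by (auto simp: gaussian_rv_def)
  then have "integrable M X \<and> integrable M (\<lambda>\<omega>. (X \<omega>)\<^sup>2)"
  proof cases
    case 1
    have 2: "integrable lborel (\<lambda>x. normal_density \<mu> s x * x)" by (rule integrable_normal_moment_nz_1[OF 1(1)])
    have "(\<lambda>x. normal_density \<mu> s x * x\<^sup>2) = (\<lambda>x. normal_density \<mu> s x * (x - \<mu>)^2
        + 2 * \<mu> * (normal_density \<mu> s x * x) - \<mu>\<^sup>2 * normal_density \<mu> s x)"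
      by (auto simp: power2_eq_square algebra_simps)
    then have "integrable lborel (\<lambda>x. normal_density \<mu> s x * x\<^sup>2)"
      using 2 integrable_normal_moment[OF 1(1), of \<mu> 2] 1(1) by simp
    then show ?thesis
      using 2 distributed_integrable[OF 1(2), of "\<lambda>x. x"] distributed_integrable[OF 1(2), of "\<lambda>x. x\<^sup>2"] by auto
  next
    case 2
    have "integrable M X \<longleftrightarrow> integrable M (\<lambda>\<omega>. \<mu>)" using 2 by (intro integrable_cong_AE) auto
    moreover have "integrable M (\<lambda>\<omega>. (X \<omega>)\<^sup>2) \<longleftrightarrow> integrable M (\<lambda>\<omega>. \<mu>\<^sup>2)" using 2 by (intro integrable_cong_AE) auto
    ultimately show ?thesis by simp
  qed
  then show "integrable M X" "integrable M (\<lambda>\<omega>. (X \<omega>)\<^sup>2)" by auto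
qed

text \<open>Solutions of d'Alembert's functional equation (cosines and hyperbolic cosines) whose mean under
the centred normal law of variance \<open>s\<^sup>2\<close> is \<open>exp (\<kappa> * s\<^sup>2)\<close>. The functional equation
reduces the mean of a product of two values to means of single values.\<close>
definition dalembert :: "(real \<Rightarrow> real) \<Rightarrow> real \<Rightarrow> bool" where
  "dalembert f \<kappa> \<longleftrightarrow> continuous_on UNIV f \<and>
     (\<forall>x y. f x * f y = (f (x + y) + f (x - y)) / 2) \<and>
     (\<forall>s. integrable lborel (\<lambda>x. std_normal_density x * f (s * x)) \<and>
          (\<integral>x. std_normal_density x * f (s * x) \<partial>lborel) = exp (\<kappa> * s\<^sup>2))"

lemma dalembert_cos: "dalembert (\<lambda>x. cos (t * x)) (- t\<^sup>2 / 2)"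
  unfolding dalembert_def
  using integral_std_normal_cos[of "t * s" for s]
  by (auto intro!: continuous_intros simp: cos_times_cos power_mult_distrib mult_ac algebra_simps)

lemma dalembert_cosh: "dalembert cosh (1 / 2)"
  unfolding dalembert_def
  using integral_std_normal_cosh
  by (auto intro!: continuous_intros simp: cosh_add cosh_diff)

text \<open>\<open>X + Y\<close> and \<open>X - Y\<close> have variances \<open>2 + 2 * \<rho>\<close> and \<open>2 - 2 * \<rho>\<close>, so the covariance of \<open>f(X)\<close> and
\<open>f(Y)\<close> equals \<open>exp (2 * \<kappa>) * (cosh (2 * \<kappa> * \<rho>) - 1)\<close>. By convexity of the exponential this
is at most \<open>\<bar>\<rho>\<bar>\<close> times its value at \<open>\<rho> = 1\<close>. Nonnegativity of the two variances gives
\<open>\<bar>\<rho>\<bar> \<le> 1\<close>.\<close>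
lemma dalembert_correlated:
  assumes M: "prob_space M" and f: "dalembert f \<kappa>"
    and X: "gaussian_rv M (\<lambda>\<omega>. X \<omega> + Y \<omega>)" "gaussian_rv M (\<lambda>\<omega>. X \<omega> - Y \<omega>)" "gaussian_rv M X" "gaussian_rv M Y"
    and EX: "prob_space.expectation M X = 0" "prob_space.expectation M Y = 0"
    and VX: "prob_space.expectation M (\<lambda>\<omega>. (X \<omega>)\<^sup>2) = 1" "prob_space.expectation M (\<lambda>\<omega>. (Y \<omega>)\<^sup>2) = 1"
    and rho: "prob_space.expectation M (\<lambda>\<omega>. X \<omega> * Y \<omega>) = \<rho>"
  shows "integrable M (\<lambda>\<omega>. (f (X \<omega>) - exp \<kappa>) * (f (Y \<omega>) - exp \<kappa>))"
    and "\<bar>prob_space.expectation M (\<lambda>\<omega>. (f (X \<omega>) - exp \<kappa>) * (f (Y \<omega>) - exp \<kappa>))\<bar>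
          \<le> exp (2 * \<kappa>) * (cosh (2 * \<kappa>) - 1) * \<bar>\<rho>\<bar>"
    and "\<bar>\<rho>\<bar> \<le> 1"
proof -
  interpret prob_space M by fact
  have [measurable]: "f \<in> borel_measurable borel"
    using f by (intro borel_measurable_continuous_onI) (auto simp: dalembert_def)
  have prod: "f x * f y = (f (x + y) + f (x - y)) / 2" for x y using f by (auto simp: dalembert_def)
  have fint: "integrable lborel (\<lambda>x. std_normal_density x * f (s * x))"
    "(\<integral>x. std_normal_density x * f (s * x) \<partial>lborel) = exp (\<kappa> * s\<^sup>2)" for s
    using f by (auto simp: dalembert_def)
  have [measurable]: "X \<in> borel_measurable M" "Y \<in> borel_measurable M" using X by (auto simp: gaussian_rv_def)
  note int = gaussian_rv_integrable[OF M X(3)] gaussian_rv_integrable[OF M X(4)]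
  have sq: "\<bar>x\<bar> * \<bar>y\<bar> \<le> x\<^sup>2 + y\<^sup>2" for x y :: real
    using sum_squares_bound[of "\<bar>x\<bar>" "\<bar>y\<bar>"] mult_nonneg_nonneg[of "\<bar>x\<bar>" "\<bar>y\<bar>"]
    unfolding power2_abs by linarith
  have intXY: "integrable M (\<lambda>\<omega>. X \<omega> * Y \<omega>)"
    by (rule Bochner_Integration.integrable_bound[of _ "\<lambda>\<omega>. (X \<omega>)\<^sup>2 + (Y \<omega>)\<^sup>2"])
       (use int sq in \<open>auto simp: abs_mult\<close>)
  have v: "expectation (\<lambda>\<omega>. (X \<omega> + Y \<omega>)\<^sup>2) = 2 + 2 * \<rho>" "expectation (\<lambda>\<omega>. (X \<omega> - Y \<omega>)\<^sup>2) = 2 - 2 * \<rho>"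
    using int intXY VX rho by (simp_all add: power2_sum power2_diff mult.assoc)
  have E: "expectation (\<lambda>\<omega>. X \<omega> + Y \<omega>) = 0" "expectation (\<lambda>\<omega>. X \<omega> - Y \<omega>) = 0"
    using int EX by simp_all
  have nn: "0 \<le> 2 + 2 * \<rho>" "0 \<le> 2 - 2 * \<rho>" unfolding v[symmetric] by simp_all
  then show r1: "\<bar>\<rho>\<bar> \<le> 1" by simp
  note T = gaussian_rv_transfer[where f=f, OF M _ _ _ _ fint(1), simplified fint(2)]
  have fX: "integrable M (\<lambda>\<omega>. f (X \<omega>))" "expectation (\<lambda>\<omega>. f (X \<omega>)) = exp \<kappa>"
    and fY: "integrable M (\<lambda>\<omega>. f (Y \<omega>))" "expectation (\<lambda>\<omega>. f (Y \<omega>)) = exp \<kappa>"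
    using T[OF X(3) EX(1) VX(1)] T[OF X(4) EX(2) VX(2)] by simp_all
  have fS: "integrable M (\<lambda>\<omega>. f (X \<omega> + Y \<omega>))" "expectation (\<lambda>\<omega>. f (X \<omega> + Y \<omega>)) = exp (\<kappa> * (2 + 2 * \<rho>))"
    and fD: "integrable M (\<lambda>\<omega>. f (X \<omega> - Y \<omega>))" "expectation (\<lambda>\<omega>. f (X \<omega> - Y \<omega>)) = exp (\<kappa> * (2 - 2 * \<rho>))"
    using T[OF X(1) E(1) v(1)] T[OF X(2) E(2) v(2)] nn by simp_all
  have expand: "(\<lambda>\<omega>. (f (X \<omega>) - exp \<kappa>) * (f (Y \<omega>) - exp \<kappa>)) =
      (\<lambda>\<omega>. (f (X \<omega> + Y \<omega>) + f (X \<omega> - Y \<omega>)) / 2 - exp \<kappa> * f (X \<omega>) - exp \<kappa> * f (Y \<omega>) + exp \<kappa> * exp \<kappa>)"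
    unfolding prod[symmetric] by (auto simp: algebra_simps)
  show "integrable M (\<lambda>\<omega>. (f (X \<omega>) - exp \<kappa>) * (f (Y \<omega>) - exp \<kappa>))"
    unfolding expand using fX fY fS fD by simp
  have "expectation (\<lambda>\<omega>. (f (X \<omega>) - exp \<kappa>) * (f (Y \<omega>) - exp \<kappa>)) =
      (exp (\<kappa> * (2 + 2 * \<rho>)) + exp (\<kappa> * (2 - 2 * \<rho>))) / 2 - exp \<kappa> * exp \<kappa>"
    unfolding expand using fX fY fS fD by (simp add: prob_space)
  also have "\<dots> = exp (2 * \<kappa>) * (cosh (2 * \<kappa> * \<bar>\<rho>\<bar>) - 1)"
    by (simp add: cosh_def distrib_left right_diff_distrib exp_add exp_diff abs_if exp_minus field_simps flip: exp_double)
       (simp only: mult_2_right exp_add)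
  finally have eq: "expectation (\<lambda>\<omega>. (f (X \<omega>) - exp \<kappa>) * (f (Y \<omega>) - exp \<kappa>)) = exp (2 * \<kappa>) * (cosh (2 * \<kappa> * \<bar>\<rho>\<bar>) - 1)" .
  have cv: "exp (\<bar>\<rho>\<bar> * w) \<le> (1 - \<bar>\<rho>\<bar>) * 1 + \<bar>\<rho>\<bar> * exp w" for w :: real
    using convex_onD[OF convex_on_exp[of 1], of "\<bar>\<rho>\<bar>" 0 w] r1 by simp
  have "cosh (2 * \<kappa> * \<bar>\<rho>\<bar>) - 1 \<le> \<bar>\<rho>\<bar> * (cosh (2 * \<kappa>) - 1)"
    using cv[of "2 * \<kappa>"] cv[of "- (2 * \<kappa>)"] by (simp add: cosh_def mult_ac field_simps)
  moreover have "0 \<le> cosh (2 * \<kappa> * \<bar>\<rho>\<bar>) - 1" using cosh_real_ge_1[of "2 * \<kappa> * \<bar>\<rho>\<bar>"] by simp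
  ultimately show "\<bar>expectation (\<lambda>\<omega>. (f (X \<omega>) - exp \<kappa>) * (f (Y \<omega>) - exp \<kappa>))\<bar>
      \<le> exp (2 * \<kappa>) * (cosh (2 * \<kappa>) - 1) * \<bar>\<rho>\<bar>"
    unfolding eq by (simp add: abs_mult mult_ac)
qed

section \<open>Second moments of path integrals\<close>

text \<open>The process is the pointwise limit of its discretizations at the points \<open>i / (n + 1)\<close>, each of which
is jointly measurable because it takes only countably many time values.\<close>
lemma measurable_continuous_paths:
  fixes Y :: "real \<Rightarrow> 'a \<Rightarrow> real"
  assumes meas [measurable]: "\<And>x. Y x \<in> borel_measurable M"
    and cont: "\<And>\<omega>. \<omega> \<in> space M \<Longrightarrow> continuous_on UNIV (\<lambda>x. Y x \<omega>)"
  shows "(\<lambda>(x, \<omega>). Y x \<omega>) \<in> borel_measurable (borel \<Otimes>\<^sub>M M)"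
proof (rule borel_measurable_LIMSEQ_real)
  define s where "s = (\<lambda>n x. real_of_int \<lfloor>x * real (Suc n)\<rfloor> / real (Suc n))"
  show "(\<lambda>z. Y (s n (fst z)) (snd z)) \<in> borel_measurable (borel \<Otimes>\<^sub>M M)" for n
  proof -
    have "(\<lambda>z. Y (real_of_int i / real (Suc n)) (snd z)) \<in> borel_measurable (borel \<Otimes>\<^sub>M M)" for i
      by measurable
    then show ?thesis
      unfolding s_def
      by (rule measurable_compose_countable[where f = "\<lambda>i z. Y (real_of_int i / real (Suc n)) (snd z)"
            and g = "\<lambda>z. \<lfloor>fst z * real (Suc n)\<rfloor>"]) measurable
  qed
  fix z assume "z \<in> space ((borel :: real measure) \<Otimes>\<^sub>M M)"
  then have om: "snd z \<in> space M" by (auto simp: space_pair_measure)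
  have "(\<lambda>n. s n (fst z)) \<longlonglongrightarrow> fst z"
  proof (rule tendsto_sandwich)
    show "eventually (\<lambda>n. fst z - inverse (real (Suc n)) \<le> s n (fst z)) sequentially"
    proof (intro always_eventually allI)
      fix n
      have "fst z * real (Suc n) - 1 \<le> real_of_int \<lfloor>fst z * real (Suc n)\<rfloor>" by linarith
      then show "fst z - inverse (real (Suc n)) \<le> s n (fst z)"
        unfolding s_def by (simp add: pos_le_divide_eq left_diff_distrib del: of_nat_Suc)
    qed
    show "eventually (\<lambda>n. s n (fst z) \<le> fst z) sequentially"
    proof (intro always_eventually allI)
      fix n
      have "real_of_int \<lfloor>fst z * real (Suc n)\<rfloor> \<le> fst z * real (Suc n)" by linarith
      then show "s n (fst z) \<le> fst z" unfolding s_def by (simp add: pos_divide_le_eq del: of_nat_Suc)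
    qed
    show "(\<lambda>n. fst z - inverse (real (Suc n))) \<longlonglongrightarrow> fst z"
      using tendsto_diff[OF tendsto_const LIMSEQ_inverse_real_of_nat, of "fst z"] by simp
  qed simp
  moreover have "isCont (\<lambda>x. Y x (snd z)) (fst z)"
    using cont[OF om] by (simp add: continuous_on_eq_continuous_at)
  ultimately show "(\<lambda>n. Y (s n (fst z)) (snd z)) \<longlonglongrightarrow> (case z of (x, \<omega>) \<Rightarrow> Y x \<omega>)"
    using isCont_tendsto_compose by (fastforce simp: case_prod_beta)
qed

text \<open>By Fubini's theorem the second moment of the integral is the double integral of the mixed
moments \<open>E (Y x * Y y)\<close> over the square \<open>[a, b] \<times> [a, b]\<close>. The diagonal strip of width \<open>2 * \<delta>\<close> contributes at most
\<open>(b - a) * 2 * \<delta> * K\<close>, and the rest of the square at most \<open>k * (b - a)\<^sup>2\<close>.\<close>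
lemma second_moment_integral:
  fixes Y :: "real \<Rightarrow> 'a \<Rightarrow> real"
  assumes M: "prob_space M" and ab: "a \<le> b" and d: "0 \<le> \<delta>" and K: "0 \<le> K" "0 \<le> k"
    and meas: "\<And>x. Y x \<in> borel_measurable M"
    and cont: "\<And>\<omega>. \<omega> \<in> space M \<Longrightarrow> continuous_on UNIV (\<lambda>x. Y x \<omega>)"
    and int: "\<And>x y. integrable M (\<lambda>\<omega>. Y x \<omega> * Y y \<omega>)"
    and bnd: "\<And>x y. \<bar>prob_space.expectation M (\<lambda>\<omega>. Y x \<omega> * Y y \<omega>)\<bar> \<le> K"
    and far: "\<And>x y. \<delta> < \<bar>x - y\<bar> \<Longrightarrow> \<bar>prob_space.expectation M (\<lambda>\<omega>. Y x \<omega> * Y y \<omega>)\<bar> \<le> k"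
  shows "integrable M (\<lambda>\<omega>. (integral {a..b} (\<lambda>x. Y x \<omega>))\<^sup>2)"
    and "prob_space.expectation M (\<lambda>\<omega>. (integral {a..b} (\<lambda>x. Y x \<omega>))\<^sup>2) \<le> (b - a) * (2 * \<delta> * K + k * (b - a))"
proof -
  interpret prob_space M by fact
  define L where "L = restrict_space lborel {a..b}"
  have spL: "space L = {a..b}" by (simp add: L_def)
  have eL: "emeasure L (space L) = ennreal (b - a)" using ab by (simp add: L_def emeasure_restrict_space)
  interpret L: finite_measure L by standard (simp add: eL)
  have mL: "measure L (space L) = b - a" using ab eL by (simp add: measure_def)
  interpret LL: pair_sigma_finite L L ..
  interpret P: finite_measure "L \<Otimes>\<^sub>M L" by (rule finite_measure_pair_measure) unfold_locales
  interpret PM: pair_sigma_finite "L \<Otimes>\<^sub>M L" M ..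
  have ident: "(\<lambda>x. x) \<in> measurable L borel" unfolding L_def by (intro measurable_restrict_space1) simp
  have Yb: "(\<lambda>(x, \<omega>). Y x \<omega>) \<in> borel_measurable (borel \<Otimes>\<^sub>M M)"
    by (rule measurable_continuous_paths[OF meas cont])
  have Y1 [measurable]: "(\<lambda>z. Y (f z) (g z)) \<in> borel_measurable N"
    if "f \<in> measurable N L" "g \<in> measurable N M" for f g and N :: "'c measure"
    using measurable_compose[OF measurable_Pair[OF measurable_compose[OF that(1) ident] that(2)] Yb] by simp
  have path_int: "integrable L (\<lambda>x. Y x \<omega>)" "integral\<^sup>L L (\<lambda>x. Y x \<omega>) = integral {a..b} (\<lambda>x. Y x \<omega>)"
    if "\<omega> \<in> space M" for \<omega>
  proof -
    have c: "continuous_on {a..b} (\<lambda>x. Y x \<omega>)" using cont[OF that] continuous_on_subset by blast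
    have si: "set_integrable lborel {a..b} (\<lambda>x. Y x \<omega>)" by (rule borel_integrable_atLeastAtMost'[OF c])
    show "integrable L (\<lambda>x. Y x \<omega>)"
      using si unfolding L_def set_integrable_def by (subst integrable_restrict_space) auto
    show "integral\<^sup>L L (\<lambda>x. Y x \<omega>) = integral {a..b} (\<lambda>x. Y x \<omega>)"
      using set_borel_integral_eq_integral(2)[OF si]
      unfolding L_def set_lebesgue_integral_def by (subst integral_restrict_space) auto
  qed
  define F where "F = (\<lambda>((x, y), \<omega>). Y x \<omega> * Y y \<omega>)"
  have Fm [measurable]: "F \<in> borel_measurable ((L \<Otimes>\<^sub>M L) \<Otimes>\<^sub>M M)"
    unfolding F_def case_prod_beta by measurable
  have sqK: "expectation (\<lambda>\<omega>. Y x \<omega> * Y x \<omega>) \<le> K" for x using bnd[of x x] by linarith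
  have abs_le: "expectation (\<lambda>\<omega>. \<bar>Y x \<omega> * Y y \<omega>\<bar>) \<le> K" for x y
  proof -
    have "\<bar>u * v\<bar> \<le> (u * u + v * v) / 2" for u v :: real
      using sum_squares_bound[of "\<bar>u\<bar>" "\<bar>v\<bar>"] by (simp add: abs_mult power2_eq_square)
    then have "expectation (\<lambda>\<omega>. \<bar>Y x \<omega> * Y y \<omega>\<bar>) \<le> expectation (\<lambda>\<omega>. (Y x \<omega> * Y x \<omega> + Y y \<omega> * Y y \<omega>) / 2)"
      using int by (intro integral_mono) auto
    also have "\<dots> = (expectation (\<lambda>\<omega>. Y x \<omega> * Y x \<omega>) + expectation (\<lambda>\<omega>. Y y \<omega> * Y y \<omega>)) / 2"
      using int by simp
    also have "\<dots> \<le> K" using sqK[of x] sqK[of y] by simp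
    finally show ?thesis .
  qed
  have Fint: "integrable ((L \<Otimes>\<^sub>M L) \<Otimes>\<^sub>M M) F"
  proof (rule PM.Fubini_integrable[OF Fm])
    show "integrable (L \<Otimes>\<^sub>M L) (\<lambda>z. \<integral>\<omega>. norm (F (z, \<omega>)) \<partial>M)"
    proof (rule P.integrable_const_bound[of _ K])
      show "AE z in L \<Otimes>\<^sub>M L. norm (\<integral>\<omega>. norm (F (z, \<omega>)) \<partial>M) \<le> K"
        using abs_le by (intro AE_I2) (auto simp: F_def split: prod.split)
    qed measurable
    show "AE z in L \<Otimes>\<^sub>M L. integrable M (\<lambda>\<omega>. F (z, \<omega>))"
      using int by (intro AE_I2) (auto simp: F_def split: prod.split)
  qed
  have sq: "(\<integral>z. F (z, \<omega>) \<partial>(L \<Otimes>\<^sub>M L)) = (integral {a..b} (\<lambda>x. Y x \<omega>))\<^sup>2" if om: "\<omega> \<in> space M" for \<omega>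
  proof -
    have m: "(\<lambda>(x, y). Y x \<omega> * Y y \<omega>) \<in> borel_measurable (L \<Otimes>\<^sub>M L)"
      using om unfolding case_prod_beta by measurable
    have i: "integrable (L \<Otimes>\<^sub>M L) (\<lambda>(x, y). Y x \<omega> * Y y \<omega>)"
      by (rule LL.Fubini_integrable[OF m]) (use path_int(1)[OF om] in \<open>auto simp: abs_mult\<close>)
    have "(\<integral>z. F (z, \<omega>) \<partial>(L \<Otimes>\<^sub>M L)) = (\<integral>x. (\<integral>y. Y x \<omega> * Y y \<omega> \<partial>L) \<partial>L)"
      by (subst LL.integral_fst[OF i]) (simp add: F_def case_prod_unfold)
    also have "\<dots> = (integral {a..b} (\<lambda>x. Y x \<omega>))\<^sup>2"
      using path_int[OF om] by (simp add: power2_eq_square)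
    finally show ?thesis .
  qed
  have Fint': "integrable ((L \<Otimes>\<^sub>M L) \<Otimes>\<^sub>M M) (\<lambda>(z, \<omega>). F (z, \<omega>))" using Fint by simp
  have "integrable M (\<lambda>\<omega>. \<integral>z. F (z, \<omega>) \<partial>(L \<Otimes>\<^sub>M L))"
    by (rule PM.integrable_snd[OF Fint'])
  then show "integrable M (\<lambda>\<omega>. (integral {a..b} (\<lambda>x. Y x \<omega>))\<^sup>2)"
    by (subst (asm) Bochner_Integration.integrable_cong[OF refl sq]) auto
  have Eint: "integrable (L \<Otimes>\<^sub>M L) (\<lambda>(x, y). expectation (\<lambda>\<omega>. Y x \<omega> * Y y \<omega>))"
    using PM.integrable_fst[OF Fint'] by (simp add: F_def case_prod_unfold)
  have "expectation (\<lambda>\<omega>. (integral {a..b} (\<lambda>x. Y x \<omega>))\<^sup>2) = expectation (\<lambda>\<omega>. \<integral>z. F (z, \<omega>) \<partial>(L \<Otimes>\<^sub>M L))"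
    by (intro Bochner_Integration.integral_cong refl sq[symmetric])
  also have "\<dots> = (\<integral>z. expectation (\<lambda>\<omega>. F (z, \<omega>)) \<partial>(L \<Otimes>\<^sub>M L))"
    by (rule PM.Fubini_integral[OF Fint'])
  also have "\<dots> = (\<integral>x. (\<integral>y. expectation (\<lambda>\<omega>. Y x \<omega> * Y y \<omega>) \<partial>L) \<partial>L)"
    by (subst LL.integral_fst[OF Eint]) (simp add: F_def case_prod_unfold)
  also have "\<dots> \<le> (\<integral>x. 2 * \<delta> * K + k * (b - a) \<partial>L)"
  proof (rule integral_mono_AE[OF LL.integrable_fst[OF Eint]])
    have A: "{x - \<delta>..x + \<delta>} \<inter> {a..b} \<in> sets L" for x by (auto simp: L_def sets_restrict_space)
    have near: "(\<integral>y. K * indicator ({x - \<delta>..x + \<delta>} \<inter> {a..b}) y + k \<partial>L) \<le> 2 * \<delta> * K + k * (b - a)" for x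
    proof -
      have "emeasure L ({x - \<delta>..x + \<delta>} \<inter> {a..b}) = emeasure lborel ({x - \<delta>..x + \<delta>} \<inter> {a..b})"
        unfolding L_def by (subst emeasure_restrict_space) auto
      also have "\<dots> \<le> emeasure lborel {x - \<delta>..x + \<delta>}" by (intro emeasure_mono) auto
      also have "\<dots> = ennreal (2 * \<delta>)" using d by simp
      finally have "measure L ({x - \<delta>..x + \<delta>} \<inter> {a..b}) \<le> 2 * \<delta>"
        using d by (simp add: L.emeasure_eq_measure)
      moreover have "(\<integral>y. K * indicator ({x - \<delta>..x + \<delta>} \<inter> {a..b}) y + k \<partial>L) =
          K * measure L ({x - \<delta>..x + \<delta>} \<inter> {a..b}) + (b - a) * k"
        using A mL by (simp add: L.emeasure_eq_measure)
      ultimately show ?thesis using K mult_left_mono[of "measure L ({x - \<delta>..x + \<delta>} \<inter> {a..b})" "2 * \<delta>" K]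
        by (simp add: mult_ac)
    qed
    show "AE x in L. (\<integral>y. expectation (\<lambda>\<omega>. Y x \<omega> * Y y \<omega>) \<partial>L) \<le> 2 * \<delta> * K + k * (b - a)"
      using LL.AE_integrable_fst[OF Eint]
    proof eventually_elim
      case (elim x)
      have "(\<integral>y. expectation (\<lambda>\<omega>. Y x \<omega> * Y y \<omega>) \<partial>L) \<le>
          (\<integral>y. K * indicator ({x - \<delta>..x + \<delta>} \<inter> {a..b}) y + k \<partial>L)"
      proof (rule integral_mono[OF elim])
        show "integrable L (\<lambda>y. K * indicator ({x - \<delta>..x + \<delta>} \<inter> {a..b}) y + k)"
          using A by (auto simp: L.emeasure_eq_measure)
        fix y assume y: "y \<in> space L"
        show "expectation (\<lambda>\<omega>. Y x \<omega> * Y y \<omega>) \<le> K * indicator ({x - \<delta>..x + \<delta>} \<inter> {a..b}) y + k"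
        proof (cases "\<delta> < \<bar>x - y\<bar>")
          case True
          have "0 \<le> K * indicator ({x - \<delta>..x + \<delta>} \<inter> {a..b}) y" using K by (auto simp: indicator_def)
          then show ?thesis using far[OF True] by linarith
        next
          case False
          then have "y \<in> {x - \<delta>..x + \<delta>} \<inter> {a..b}" using y by (auto simp: spL)
          then show ?thesis using bnd[of x y] K by simp
        qed
      qed
      then show ?case using near[of x] by linarith
    qed
  qed simp
  also have "\<dots> = (b - a) * (2 * \<delta> * K + k * (b - a))" using mL by simp
  finally show "expectation (\<lambda>\<omega>. (integral {a..b} (\<lambda>x. Y x \<omega>))\<^sup>2) \<le> (b - a) * (2 * \<delta> * K + k * (b - a))" .
qed

text \<open>The sum of the squares \<open>(V n)\<^sup>2\<close> has finite expectation, hence it is finite almost surely.\<close>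
lemma AE_tendsto_0_of_summable_second_moments:
  fixes V :: "nat \<Rightarrow> 'a \<Rightarrow> real"
  assumes int: "\<And>n. integrable M (\<lambda>\<omega>. (V n \<omega>)\<^sup>2)" and sm: "summable (\<lambda>n. \<integral>\<omega>. (V n \<omega>)\<^sup>2 \<partial>M)"
  shows "AE \<omega> in M. (\<lambda>n. V n \<omega>) \<longlonglongrightarrow> 0"
proof -
  have m [measurable]: "(\<lambda>\<omega>. (V n \<omega>)\<^sup>2) \<in> borel_measurable M" for n using int[of n] by auto
  have "(\<integral>\<^sup>+\<omega>. (\<Sum>n. ennreal ((V n \<omega>)\<^sup>2)) \<partial>M) = (\<Sum>n. \<integral>\<^sup>+\<omega>. ennreal ((V n \<omega>)\<^sup>2) \<partial>M)"
    by (rule nn_integral_suminf) measurable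
  also have "\<dots> = (\<Sum>n. ennreal (\<integral>\<omega>. (V n \<omega>)\<^sup>2 \<partial>M))"
    using int by (intro suminf_cong nn_integral_eq_integral) auto
  also have "\<dots> = ennreal (\<Sum>n. \<integral>\<omega>. (V n \<omega>)\<^sup>2 \<partial>M)"
    by (intro suminf_ennreal2 sm) auto
  finally have "(\<integral>\<^sup>+\<omega>. (\<Sum>n. ennreal ((V n \<omega>)\<^sup>2)) \<partial>M) \<noteq> \<infinity>" by simp
  then have "AE \<omega> in M. (\<Sum>n. ennreal ((V n \<omega>)\<^sup>2)) \<noteq> \<infinity>"
    by (intro nn_integral_PInf_AE) auto
  then show ?thesis
  proof eventually_elim
    case (elim \<omega>)
    then have "summable (\<lambda>n. (V n \<omega>)\<^sup>2)"
      by (intro summable_suminf_not_top) (auto simp: top_ennreal_def)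
    then have "(\<lambda>n. (V n \<omega>)\<^sup>2) \<longlonglongrightarrow> 0" by (rule summable_LIMSEQ_zero)
    then show ?case by (simp add: power_tendsto_0_iff)
  qed
qed

section \<open>Averages of powers from averages of cosines\<close>

lemma powr_le_exp_eventually:
  fixes p e :: real
  assumes "0 < e"
  obtains L where "0 < L" "\<And>x. L \<le> x \<Longrightarrow> x powr p \<le> e * exp x"
proof -
  have "((\<lambda>x::real. x powr p / exp x) \<longlongrightarrow> 0) at_top" by real_asymp
  then have "eventually (\<lambda>x::real. x powr p / exp x < e) at_top"
    using assms by (intro order_tendstoD) auto
  then obtain L0 where L0: "\<And>x. L0 \<le> x \<Longrightarrow> x powr p / exp x < e"
    by (auto simp: eventually_at_top_linorder)
  show thesis
  proof (rule that[of "max L0 1"])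
    show "x powr p \<le> e * exp x" if "max L0 1 \<le> x" for x
      using L0[of x] that by (simp add: divide_less_eq less_imp_le)
  qed simp
qed

text \<open>On \<open>[-L, L]\<close> the function \<open>\<bar>x\<bar> powr p\<close> is a continuous function \<open>w\<close> of \<open>cos (pi * x / L)\<close>, namely
through \<open>arccos\<close>, and Weierstrass' theorem replaces \<open>w\<close> by a polynomial. Outside \<open>[-L, L]\<close> the
polynomial is bounded by about \<open>L powr p\<close>, and both functions are negligible compared with
\<open>cosh\<close> if \<open>L\<close> is large.\<close>
lemma powr_approx_cos_polynomial:
  fixes p e :: real
  assumes p: "1 \<le> p" and e: "0 < e"
  obtains n :: nat and a :: "nat \<Rightarrow> real" and s :: real
  where "\<And>x. \<bar>\<bar>x\<bar> powr p - (\<Sum>i\<le>n. a i * cos (s * x) ^ i)\<bar> \<le> e * cosh x"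
proof -
  obtain L where L: "0 < L" "\<And>x. L \<le> x \<Longrightarrow> x powr p \<le> e / 8 * exp x"
    using powr_le_exp_eventually[of "e / 8" p] e by auto
  define w where "w = (\<lambda>y. (arccos y * L / pi) powr p)"
  have "continuous_on {-1..1} w"
    unfolding w_def using p L(1) arccos_lbound
    by (intro continuous_on_powr' continuous_intros continuous_on_arccos') auto
  then obtain g where g: "real_polynomial_function g" "\<And>y. y \<in> {-1..1} \<Longrightarrow> \<bar>w y - g y\<bar> < e / 2"
    using Stone_Weierstrass_real_polynomial_function[of "{-1..1}" w "e / 2"] e by auto
  obtain a n where gn: "g = (\<lambda>y. \<Sum>i\<le>n. a i * y ^ i)"
    using g(1) real_polynomial_function_iff_sum by auto
  show thesis
  proof (rule that[of a "pi / L" n])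
    fix x :: real
    define y where "y = cos (pi / L * x)"
    have y: "y \<in> {-1..1}" by (simp add: y_def)
    have gy: "\<bar>w y - g y\<bar> < e / 2" by (rule g(2)[OF y])
    have ch: "exp \<bar>x\<bar> / 2 \<le> cosh x" by (simp add: cosh_def abs_if)
    have ec: "e \<le> e * cosh x" using e cosh_real_ge_1[of x] by simp
    have "\<bar>\<bar>x\<bar> powr p - g y\<bar> \<le> e * cosh x"
    proof (cases "\<bar>x\<bar> \<le> L")
      case True
      have "y = cos (pi / L * \<bar>x\<bar>)" by (simp add: y_def abs_if)
      moreover have "pi / L * \<bar>x\<bar> \<le> pi / L * L" using True L by (intro mult_left_mono) auto
      ultimately have "arccos y = pi / L * \<bar>x\<bar>" using L by (simp add: arccos_cos)
      then have "w y = \<bar>x\<bar> powr p" using L by (simp add: w_def)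
      then show ?thesis using gy ec e by linarith
    next
      case False
      have "arccos y * L / pi \<le> L"
        using L(1) arccos_ubound[of y] y by (simp add: divide_le_eq mult.commute)
      moreover have "0 \<le> arccos y * L / pi" using L(1) arccos_lbound[of y] y by simp
      ultimately have "w y \<le> L powr p" "0 \<le> w y" unfolding w_def using p by (auto intro!: powr_mono2)
      moreover have "L powr p \<le> \<bar>x\<bar> powr p" using False L p by (intro powr_mono2) auto
      moreover have "\<bar>x\<bar> powr p \<le> e / 8 * exp \<bar>x\<bar>" using False by (intro L(2)) auto
      moreover have "e / 4 * exp \<bar>x\<bar> \<le> e / 2 * cosh x"
        using mult_left_mono[OF ch, of "e / 2"] e by simp
      ultimately show ?thesis using gy ec e by linarith
    qed
    then show "\<bar>\<bar>x\<bar> powr p - (\<Sum>i\<le>n. a i * cos (pi / L * x) ^ i)\<bar> \<le> e * cosh x"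
      by (simp add: gn y_def)
  qed
qed

text \<open>The law of large numbers for the averages of \<open>f(Z n)\<close> over \<open>[a, b]\<close>. Continuity and integrability
are part of the notion because they make it closed under linear combinations.\<close>
definition averages_to_normal ::
    "'a measure \<Rightarrow> (nat \<Rightarrow> real \<Rightarrow> 'a \<Rightarrow> real) \<Rightarrow> real \<Rightarrow> real \<Rightarrow> (real \<Rightarrow> real) \<Rightarrow> bool" where
  "averages_to_normal M Z a b f \<longleftrightarrow>
     continuous_on UNIV f \<and> integrable lborel (\<lambda>x. std_normal_density x * f x) \<and>
     (AE \<omega> in M. (\<lambda>n. integral {a..b} (\<lambda>x. f (Z n x \<omega>)))
        \<longlonglongrightarrow> (\<integral>x. std_normal_density x * f x \<partial>lborel) * (b - a))"

context
  fixes M :: "'a measure" and Z :: "nat \<Rightarrow> real \<Rightarrow> 'a \<Rightarrow> real" and a b :: real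
  assumes Zcont: "\<And>n \<omega>. \<omega> \<in> space M \<Longrightarrow> continuous_on UNIV (\<lambda>x. Z n x \<omega>)"
begin

lemma path_integrable:
  assumes "continuous_on UNIV f" "\<omega> \<in> space M"
  shows "(\<lambda>x. f (Z n x \<omega>) :: real) integrable_on {a..b}"
  by (intro integrable_continuous_real continuous_on_compose2[OF assms(1)]
      continuous_on_subset[OF Zcont[OF assms(2)]]) auto

lemma averages_to_normal_lincomb:
  assumes "averages_to_normal M Z a b f" "averages_to_normal M Z a b g"
  shows "averages_to_normal M Z a b (\<lambda>x. c * f x + d * g x)"
proof -
  have f: "continuous_on UNIV f" "integrable lborel (\<lambda>x. std_normal_density x * f x)"
      "AE \<omega> in M. (\<lambda>n. integral {a..b} (\<lambda>x. f (Z n x \<omega>)))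
        \<longlonglongrightarrow> (\<integral>x. std_normal_density x * f x \<partial>lborel) * (b - a)"
    and g: "continuous_on UNIV g" "integrable lborel (\<lambda>x. std_normal_density x * g x)"
      "AE \<omega> in M. (\<lambda>n. integral {a..b} (\<lambda>x. g (Z n x \<omega>)))
        \<longlonglongrightarrow> (\<integral>x. std_normal_density x * g x \<partial>lborel) * (b - a)"
    using assms by (auto simp: averages_to_normal_def)
  have eq: "std_normal_density x * (c * f x + d * g x) =
      c * (std_normal_density x * f x) + d * (std_normal_density x * g x)" for x
    by (simp add: algebra_simps)
  have E: "(\<integral>x. std_normal_density x * (c * f x + d * g x) \<partial>lborel) =
      c * (\<integral>x. std_normal_density x * f x \<partial>lborel) + d * (\<integral>x. std_normal_density x * g x \<partial>lborel)"
    unfolding eq using f g by simp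
  show ?thesis
    unfolding averages_to_normal_def E
  proof (intro conjI)
    show "continuous_on UNIV (\<lambda>x. c * f x + d * g x)" using f g by (intro continuous_intros)
    show "integrable lborel (\<lambda>x. std_normal_density x * (c * f x + d * g x))"
      unfolding eq using f g by simp
    show "AE \<omega> in M. (\<lambda>n. integral {a..b} (\<lambda>x. c * f (Z n x \<omega>) + d * g (Z n x \<omega>)))
      \<longlonglongrightarrow> (c * (\<integral>x. std_normal_density x * f x \<partial>lborel) + d * (\<integral>x. std_normal_density x * g x \<partial>lborel)) * (b - a)"
      using f(3) g(3) AE_space
    proof eventually_elim
      case (elim \<omega>)
      have "integral {a..b} (\<lambda>x. c * f (Z n x \<omega>) + d * g (Z n x \<omega>)) =
          c * integral {a..b} (\<lambda>x. f (Z n x \<omega>)) + d * integral {a..b} (\<lambda>x. g (Z n x \<omega>))" for n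
        using path_integrable[OF f(1) elim(3)] path_integrable[OF g(1) elim(3)]
        by (simp add: integral_add integrable_on_mult_right)
      moreover have "(\<lambda>n. c * integral {a..b} (\<lambda>x. f (Z n x \<omega>)) + d * integral {a..b} (\<lambda>x. g (Z n x \<omega>)))
        \<longlonglongrightarrow> c * ((\<integral>x. std_normal_density x * f x \<partial>lborel) * (b - a))
          + d * ((\<integral>x. std_normal_density x * g x \<partial>lborel) * (b - a))"
        using elim by (intro tendsto_intros)
      ultimately show ?case by (simp add: algebra_simps)
    qed
  qed
qed

text \<open>Products of cosines are sums of cosines; the additional factor \<open>cos (t * x)\<close> with arbitrary \<open>t\<close>
is what makes the induction on \<open>k\<close> go through.\<close>
lemma averages_to_normal_cos_power:
  assumes cos: "\<And>t. averages_to_normal M Z a b (\<lambda>x. cos (t * x))"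
  shows "averages_to_normal M Z a b (\<lambda>x. cos (s * x) ^ k * cos (t * x))"
proof (induction k arbitrary: t)
  case 0
  then show ?case using cos by simp
next
  case (Suc k)
  have "cos (s * x) ^ Suc k * cos (t * x) =
      1 / 2 * (cos (s * x) ^ k * cos ((s - t) * x)) + 1 / 2 * (cos (s * x) ^ k * cos ((s + t) * x))" for x
  proof -
    have "cos (s * x) ^ Suc k * cos (t * x) = cos (s * x) ^ k * (cos (s * x) * cos (t * x))" by simp
    also have "cos (s * x) * cos (t * x) = (cos ((s - t) * x) + cos ((s + t) * x)) / 2"
      by (simp add: cos_times_cos left_diff_distrib distrib_right)
    finally show ?thesis by (simp add: field_simps)
  qed
  then show ?case
    using averages_to_normal_lincomb[OF Suc.IH[of "s - t"] Suc.IH[of "s + t"], of "1/2" "1/2"] by presburger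
qed

lemma averages_to_normal_cos_polynomial:
  assumes cos: "\<And>t. averages_to_normal M Z a b (\<lambda>x. cos (t * x))"
  shows "averages_to_normal M Z a b (\<lambda>x. \<Sum>i\<le>n. c i * cos (s * x) ^ i)"
proof (induction n)
  case 0
  show ?case
    using averages_to_normal_lincomb[OF cos[of 0] cos[of 0], of "c 0" 0] by simp
next
  case (Suc n)
  show ?case
    using averages_to_normal_lincomb[OF Suc averages_to_normal_cos_power[OF cos, of s "Suc n" 0], of 1 "c (Suc n)"]
    by simp
qed

text \<open>For each \<open>e > 0\<close> choose a cosine polynomial \<open>T e\<close> within \<open>e * cosh x\<close> of \<open>\<bar>x\<bar> powr p\<close>. The averages
of both functions differ by at most \<open>e\<close> times the average of \<open>cosh\<close>, which converges, and their
means under the normal law by at most \<open>e\<close> times the mean of \<open>cosh\<close>. Letting \<open>e\<close> run through \<open>1 / (m + 1)\<close> keeps the exceptional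
set null.\<close>
lemma averages_to_normal_powr:
  assumes ab: "a \<le> b" and p: "1 \<le> p"
    and cos: "\<And>t. averages_to_normal M Z a b (\<lambda>x. cos (t * x))"
    and cosh: "averages_to_normal M Z a b cosh"
  shows "averages_to_normal M Z a b (\<lambda>x. \<bar>x\<bar> powr p)"
proof -
  define D :: "real \<Rightarrow> real" where "D = std_normal_density"
  define N where "N = (\<lambda>f. \<integral>x. D x * f x \<partial>lborel)"
  define A where "A = (\<lambda>n \<omega> f. integral {a..b} (\<lambda>x. f (Z n x \<omega>) :: real))"
  have Dnn: "0 \<le> D x" for x by (simp add: D_def)
  have Dm [measurable]: "D \<in> borel_measurable borel" by (simp add: D_def)
  define P :: "real \<Rightarrow> real" where "P = (\<lambda>x. \<bar>x\<bar> powr p)"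
  have Pc: "continuous_on UNIV P"
    unfolding P_def using p by (intro continuous_on_powr' continuous_intros) auto
  have Pm [measurable]: "P \<in> borel_measurable borel" using Pc by (rule borel_measurable_continuous_onI)
  have ex: "\<exists>T. averages_to_normal M Z a b T \<and> (\<forall>x. \<bar>P x - T x\<bar> \<le> e * cosh x)" if e: "0 < e" for e
  proof -
    obtain n c s where "\<And>x. \<bar>\<bar>x\<bar> powr p - (\<Sum>i\<le>n. c i * cos (s * x) ^ i)\<bar> \<le> e * cosh x"
      using powr_approx_cos_polynomial[OF p e] by metis
    then show ?thesis
      unfolding P_def
      by (intro exI[of _ "\<lambda>x. \<Sum>i\<le>n. c i * cos (s * x) ^ i"] conjI allI averages_to_normal_cos_polynomial cos)
  qed
  define T where "T = (\<lambda>e. SOME T. averages_to_normal M Z a b T \<and> (\<forall>x. \<bar>P x - T x\<bar> \<le> e * cosh x))"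
  have T: "averages_to_normal M Z a b (T e)" and PT: "\<bar>P x - T e x\<bar> \<le> e * cosh x" if "0 < e" for e x
    using someI_ex[OF ex[OF that]] unfolding T_def by blast+
  have Ti: "integrable lborel (\<lambda>x. D x * T e x)" "continuous_on UNIV (T e)"
    "AE \<omega> in M. (\<lambda>n. A n \<omega> (T e)) \<longlonglongrightarrow> N (T e) * (b - a)" if "0 < e" for e
    using T[OF that] by (auto simp: averages_to_normal_def D_def N_def A_def)
  have Ci: "integrable lborel (\<lambda>x. D x * cosh x)" "continuous_on UNIV (cosh :: real \<Rightarrow> real)"
    "AE \<omega> in M. (\<lambda>n. A n \<omega> cosh) \<longlonglongrightarrow> N cosh * (b - a)"
    using cosh by (auto simp: averages_to_normal_def D_def N_def A_def)
  \<comment> \<open>Integrability of \<open>P\<close> is itself a consequence of the approximation, with \<open>e = 1\<close>.\<close>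
  have Pi: "integrable lborel (\<lambda>x. D x * P x)"
  proof (rule Bochner_Integration.integrable_bound)
    show "integrable lborel (\<lambda>x. \<bar>D x * T 1 x\<bar> + D x * cosh x)" using Ti(1)[of 1] Ci(1) by simp
    have "\<bar>D x * P x\<bar> \<le> \<bar>D x * T 1 x\<bar> + D x * cosh x" for x
    proof -
      have "\<bar>P x\<bar> \<le> \<bar>T 1 x\<bar> + cosh x" using PT[of 1 x] by simp
      then have "D x * \<bar>P x\<bar> \<le> D x * (\<bar>T 1 x\<bar> + cosh x)" by (rule mult_left_mono) (rule Dnn)
      then show ?thesis using Dnn[of x] by (simp add: abs_mult distrib_left)
    qed
    then show "AE x in lborel. norm (D x * P x) \<le> norm (\<bar>D x * T 1 x\<bar> + D x * cosh x)"
      by (intro AE_I2) (metis abs_ge_self order_trans real_norm_def)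
  qed simp
  have Cnn: "0 \<le> N cosh" unfolding N_def
    using Dnn by (intro Bochner_Integration.integral_nonneg_AE AE_I2) auto
  have NPT: "\<bar>N P - N (T e)\<bar> \<le> e * N cosh" if e: "0 < e" for e
  proof -
    have "N P - N (T e) = (\<integral>x. D x * (P x - T e x) \<partial>lborel)"
      using Pi Ti(1)[OF e] by (simp add: N_def right_diff_distrib)
    also have "\<bar>\<dots>\<bar> \<le> (\<integral>x. e * (D x * cosh x) \<partial>lborel)"
    proof (rule order_trans[OF integral_abs_bound integral_mono])
      have i: "integrable lborel (\<lambda>x. D x * (P x - T e x))"
        using Pi Ti(1)[OF e] by (simp add: right_diff_distrib)
      then show "integrable lborel (\<lambda>x. \<bar>D x * (P x - T e x)\<bar>)" by simp
      show "integrable lborel (\<lambda>x. e * (D x * cosh x))" using Ci by simp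
      fix x :: real
      show "\<bar>D x * (P x - T e x)\<bar> \<le> e * (D x * cosh x)"
        using mult_left_mono[OF PT[OF e, of x] Dnn[of x]] Dnn[of x] by (simp add: abs_mult mult_ac)
    qed
    also have "\<dots> = e * N cosh" by (simp add: N_def)
    finally show ?thesis .
  qed
  have "AE \<omega> in M. \<forall>m. (\<lambda>n. A n \<omega> (T (inverse (real (Suc m))))) \<longlonglongrightarrow> N (T (inverse (real (Suc m)))) * (b - a)"
    unfolding AE_all_countable by (intro allI Ti(3)) simp
  then have "AE \<omega> in M. (\<lambda>n. A n \<omega> P) \<longlonglongrightarrow> N P * (b - a)"
    using Ci(3) AE_space
  proof eventually_elim
    case (elim \<omega>)
    have AP: "\<bar>A n \<omega> P - A n \<omega> (T e)\<bar> \<le> e * A n \<omega> cosh" if e: "0 < e" for e n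
    proof -
      note i = path_integrable[OF _ elim(3)]
      have "A n \<omega> P - A n \<omega> (T e) = integral {a..b} (\<lambda>x. P (Z n x \<omega>) - T e (Z n x \<omega>))"
        unfolding A_def using i[OF Pc] i[OF Ti(2)[OF e]] by (simp add: integral_diff)
      also have "norm \<dots> \<le> integral {a..b} (\<lambda>x. e * cosh (Z n x \<omega>))"
        using i[OF Pc] i[OF Ti(2)[OF e]] i[OF Ci(2)] PT[OF e]
        by (intro integral_norm_bound_integral integrable_diff integrable_on_mult_right) auto
      also have "\<dots> = e * A n \<omega> cosh" by (simp add: A_def)
      finally show ?thesis by simp
    qed
    show ?case
    proof (rule LIMSEQ_I)
      fix \<epsilon> :: real assume eps: "0 < \<epsilon>"
      \<comment> \<open>The total error is \<open>e * C\<close>: \<open>e * (N cosh * (b - a) + 1)\<close> from replacing \<open>P\<close> by \<open>T e\<close> in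
          the average, \<open>e\<close> from the convergence for \<open>T e\<close>, and \<open>e * N cosh * (b - a)\<close> from
          replacing \<open>T e\<close> by \<open>P\<close> in the limit.\<close>
      define C where "C = 2 * (N cosh * (b - a)) + 2"
      have NC: "0 \<le> N cosh * (b - a)" using Cnn ab by simp
      then have C: "0 < C" by (simp add: C_def)
      obtain m where m: "inverse (real (Suc m)) < \<epsilon> / C"
        using reals_Archimedean[of "\<epsilon> / C"] eps C by auto
      define e where "e = inverse (real (Suc m))"
      have e: "0 < e" "e * C < \<epsilon>" using m C by (auto simp: e_def field_simps)
      have "eventually (\<lambda>n. \<bar>A n \<omega> (T e) - N (T e) * (b - a)\<bar> < e) sequentially"
        using tendstoD[OF elim(1)[rule_format, of m, folded e_def] e(1)] by (simp add: dist_real_def)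
      moreover have "eventually (\<lambda>n. A n \<omega> cosh < N cosh * (b - a) + 1) sequentially"
        using elim(2) by (rule order_tendstoD) simp
      ultimately have "eventually (\<lambda>n. norm (A n \<omega> P - N P * (b - a)) < \<epsilon>) sequentially"
      proof eventually_elim
        case (elim n)
        have "e * A n \<omega> cosh \<le> e * (N cosh * (b - a) + 1)" using elim e by (intro mult_left_mono) auto
        moreover have "\<bar>N (T e) * (b - a) - N P * (b - a)\<bar> \<le> e * N cosh * (b - a)"
          using mult_right_mono[OF NPT[OF e(1)], of "b - a"] ab
          by (simp add: left_diff_distrib[symmetric] abs_mult abs_minus_commute)
        moreover have "e * (N cosh * (b - a) + 1) + e + e * N cosh * (b - a) = e * C"
          by (simp add: C_def algebra_simps)
        ultimately show ?case using AP[OF e(1), of n] elim e(2) unfolding real_norm_def by linarith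
      qed
      then show "\<exists>no. \<forall>n\<ge>no. norm (A n \<omega> P - N P * (b - a)) < \<epsilon>"
        by (simp add: eventually_sequentially)
    qed
  qed
  then show ?thesis
    using Pc Pi unfolding averages_to_normal_def P_def[symmetric] D_def[symmetric] N_def A_def by simp
qed

end

section \<open>Fractional Brownian motion\<close>

text \<open>The mean value theorem, applied to both first differences and then to their difference,
reduces the second difference to a bounded multiple of the second derivative
\<open>r * (r - 1) * z powr (r - 2)\<close> at some
\<open>z > v - 1 \<ge> v / 2\<close>.\<close>
lemma second_difference_powr_decay:
  fixes r v :: real
  assumes r: "0 < r" "r < 2" and v: "2 \<le> v"
  shows "\<bar>(v + 1) powr r + (v - 1) powr r - 2 * v powr r\<bar> \<le> 4 * (v / 2) powr (r - 2)"
proof -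
  have d1: "((\<lambda>x. x powr s) has_real_derivative s * x powr (s - 1)) (at x)" if "0 < x" for x s :: real
    using that by (auto intro!: derivative_eq_intros)
  have d2: "((\<lambda>x. x powr (r - 1)) has_real_derivative (r - 1) * x powr (r - 2)) (at x)" if "0 < x" for x
    using d1[OF that, of "r - 1"] by simp
  obtain x1 where x1: "v < x1" "x1 < v + 1" "(v + 1) powr r - v powr r = r * x1 powr (r - 1)"
    using MVT2[of v "v + 1" "\<lambda>x. x powr r" "\<lambda>x. r * x powr (r - 1)"] d1 v by auto
  obtain x2 where x2: "v - 1 < x2" "x2 < v" "v powr r - (v - 1) powr r = r * x2 powr (r - 1)"
    using MVT2[of "v - 1" v "\<lambda>x. x powr r" "\<lambda>x. r * x powr (r - 1)"] d1 v by auto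
  obtain z where z: "x2 < z" "z < x1" "x1 powr (r - 1) - x2 powr (r - 1) = (x1 - x2) * ((r - 1) * z powr (r - 2))"
    using MVT2[of x2 x1 "\<lambda>x. x powr (r - 1)" "\<lambda>x. (r - 1) * x powr (r - 2)"] d2 x1 x2 v by auto
  have "(v + 1) powr r + (v - 1) powr r - 2 * v powr r = r * (x1 powr (r - 1) - x2 powr (r - 1))"
    using x1(3) x2(3) by (simp add: right_diff_distrib)
  also have "\<dots> = (r * (r - 1)) * ((x1 - x2) * z powr (r - 2))" using z(3) by simp
  also have "\<bar>\<dots>\<bar> = (r * \<bar>r - 1\<bar>) * ((x1 - x2) * z powr (r - 2))"
    using r x1 x2 by (simp add: abs_mult)
  also have "\<dots> \<le> (2 * 1) * (2 * (v / 2) powr (r - 2))"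
  proof (intro mult_mono)
    show "z powr (r - 2) \<le> (v / 2) powr (r - 2)" using z x2 v r by (intro powr_mono2') auto
  qed (use r x1 x2 in auto)
  finally show ?thesis by simp
qed

definition increment_correlation :: "real \<Rightarrow> real \<Rightarrow> real \<Rightarrow> real" where
  "increment_correlation r h u = (\<bar>u + h\<bar> powr r + \<bar>u - h\<bar> powr r - 2 * \<bar>u\<bar> powr r) / (2 * h powr r)"

text \<open>By homogeneity the correlation depends only on \<open>v = \<bar>u\<bar> / h\<close>.\<close>
lemma increment_correlation_decay:
  assumes r: "0 < r" "r < 2" and h: "0 < h" and u: "2 * h \<le> d" "d \<le> \<bar>u\<bar>"
  shows "\<bar>increment_correlation r h u\<bar> \<le> 2 * (d / (2 * h)) powr (r - 2)"
proof -
  define v where "v = \<bar>u\<bar> / h"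
  have v: "2 \<le> v" "d / (2 * h) \<le> v / 2" "0 < d / (2 * h)"
    using u h by (auto simp: v_def field_simps)
  have u_eq: "\<bar>u\<bar> = h * v" using h by (simp add: v_def)
  have sym: "\<bar>u + h\<bar> powr r + \<bar>u - h\<bar> powr r = (\<bar>u\<bar> + h) powr r + (\<bar>u\<bar> - h) powr r"
  proof (cases "0 \<le> u")
    case True then show ?thesis using u h by simp
  next
    case False
    then have "\<bar>u + h\<bar> = \<bar>u\<bar> - h" "\<bar>u - h\<bar> = \<bar>u\<bar> + h" using u h by auto
    then show ?thesis by simp
  qed
  have uv: "\<bar>u\<bar> + h = h * (v + 1)" "\<bar>u\<bar> - h = h * (v - 1)" by (simp_all add: u_eq algebra_simps)
  have "increment_correlation r h u = ((v + 1) powr r + (v - 1) powr r - 2 * v powr r) / 2"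
    using h v(1) unfolding increment_correlation_def sym uv unfolding u_eq
    by (simp only: powr_mult) (simp add: divide_simps, simp add: algebra_simps)
  then have "\<bar>increment_correlation r h u\<bar> \<le> 2 * (v / 2) powr (r - 2)"
    using second_difference_powr_decay[OF r v(1)] by simp
  also have "\<dots> \<le> 2 * (d / (2 * h)) powr (r - 2)"
    using v r by (intro mult_left_mono powr_mono2') auto
  finally show ?thesis .
qed

definition normalized_incr :: "real \<Rightarrow> (real \<Rightarrow> 'a \<Rightarrow> real) \<Rightarrow> real \<Rightarrow> real \<Rightarrow> 'a \<Rightarrow> real" where
  "normalized_incr r G h x \<omega> = (G (x + h) \<omega> - G x \<omega>) / fbm_sigma r h"

context
  fixes M :: "'a measure" and r :: real and G :: "real \<Rightarrow> 'a \<Rightarrow> real"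
  assumes r: "0 < r" "r < 2" and fbm: "fractional_brownian_motion M r G"
begin

interpretation prob_space M using fbm by (simp add: fractional_brownian_motion_def)

text \<open>Four terms suffice for linear combinations of two increments. The points may coincide, so the
coefficients are added up over the set of distinct points.\<close>
lemma fbm_gaussian:
  "gaussian_rv M (\<lambda>\<omega>. \<alpha>1 * G x1 \<omega> + \<alpha>2 * G x2 \<omega> + \<alpha>3 * G x3 \<omega> + \<alpha>4 * G x4 \<omega>)"
proof -
  define T where "T = {x1, x2, x3, x4}"
  define c where "c = (\<lambda>t. (if t = x1 then \<alpha>1 else 0) + (if t = x2 then \<alpha>2 else 0)
    + (if t = x3 then \<alpha>3 else 0) + (if t = x4 then \<alpha>4 else 0))"
  have T: "finite T" "x1 \<in> T" "x2 \<in> T" "x3 \<in> T" "x4 \<in> T" by (auto simp: T_def)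
  have *: "(if t = x then \<alpha> else 0) * G t \<omega> = (if t = x then \<alpha> * G t \<omega> else 0)" for t x \<alpha> \<omega> by simp
  have "(\<Sum>t\<in>T. c t * G t \<omega>) = \<alpha>1 * G x1 \<omega> + \<alpha>2 * G x2 \<omega> + \<alpha>3 * G x3 \<omega> + \<alpha>4 * G x4 \<omega>" for \<omega>
    unfolding c_def distrib_right sum.distrib * using T by (simp add: sum.delta)
  moreover have "gaussian_rv M (\<lambda>\<omega>. \<Sum>t\<in>T. c t * G t \<omega>)"
    using fbm T(1) by (simp add: fractional_brownian_motion_def gaussian_process_def)
  ultimately show ?thesis by simp
qed

lemma fbm_gaussian1: "gaussian_rv M (G x)"
  using fbm_gaussian[of 1 x 0 x 0 x 0 x] by simp

lemma fbm_integrable: "integrable M (G x)"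
  by (rule gaussian_rv_integrable(1)[OF prob_space_axioms fbm_gaussian1])

lemma fbm_mean: "expectation (G x) = 0"
  using fbm by (simp add: fractional_brownian_motion_def)

lemma fbm_measurable [measurable]: "G x \<in> borel_measurable M"
  using fbm_integrable by blast

lemma fbm_continuous: "\<omega> \<in> space M \<Longrightarrow> continuous_on UNIV (\<lambda>x. G x \<omega>)"
  using fbm by (simp add: fractional_brownian_motion_def)

lemma fbm_incr_square:
  "integrable M (\<lambda>\<omega>. (G x \<omega> - G y \<omega>)\<^sup>2)" "expectation (\<lambda>\<omega>. (G x \<omega> - G y \<omega>)\<^sup>2) = \<bar>x - y\<bar> powr r"
proof -
  have "expectation (\<lambda>\<omega>. (G (y + (x - y)) \<omega> - G y \<omega>)\<^sup>2) = \<bar>x - y\<bar> powr r"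
    using fbm unfolding fractional_brownian_motion_def by blast
  then show "expectation (\<lambda>\<omega>. (G x \<omega> - G y \<omega>)\<^sup>2) = \<bar>x - y\<bar> powr r" by simp
  have "gaussian_rv M (\<lambda>\<omega>. G x \<omega> - G y \<omega>)" using fbm_gaussian[of 1 x "-1" y 0 x 0 x] by simp
  then show "integrable M (\<lambda>\<omega>. (G x \<omega> - G y \<omega>)\<^sup>2)"
    by (rule gaussian_rv_integrable(2)[OF prob_space_axioms])
qed

text \<open>The product of two increments is a combination of four squares of differences of values of \<open>G\<close>,
whose expectations are known.\<close>
lemma fbm_incr_covariance:
  "expectation (\<lambda>\<omega>. (G (x + h) \<omega> - G x \<omega>) * (G (y + h) \<omega> - G y \<omega>)) =
    (\<bar>x - y + h\<bar> powr r + \<bar>x - y - h\<bar> powr r - 2 * \<bar>x - y\<bar> powr r) / 2"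
proof -
  have pol: "(A - B) * (C - D) = ((A - D)\<^sup>2 + (B - C)\<^sup>2 - (A - C)\<^sup>2 - (B - D)\<^sup>2) / 2" for A B C D :: real
    by (simp add: power2_eq_square algebra_simps)
  have "expectation (\<lambda>\<omega>. (G (x + h) \<omega> - G x \<omega>) * (G (y + h) \<omega> - G y \<omega>)) =
      (\<bar>x + h - y\<bar> powr r + \<bar>x - (y + h)\<bar> powr r - \<bar>x + h - (y + h)\<bar> powr r - \<bar>x - y\<bar> powr r) / 2"
    unfolding pol by (simp add: fbm_incr_square)
  then show ?thesis by (simp add: algebra_simps)
qed


lemma fbm_sigma_square: "0 < h \<Longrightarrow> (fbm_sigma r h)\<^sup>2 = h powr r" "0 < h \<Longrightarrow> 0 < fbm_sigma r h"
  by (simp_all add: fbm_sigma_def power2_eq_square flip: powr_add)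

lemma normalized_incr_continuous:
  "\<omega> \<in> space M \<Longrightarrow> continuous_on UNIV (\<lambda>x. normalized_incr r G h x \<omega>)"
  unfolding normalized_incr_def divide_inverse
  by (intro continuous_on_mult continuous_on_const continuous_incr fbm_continuous)

lemma normalized_incr_gaussian:
  assumes h: "0 < h"
  shows "gaussian_rv M (\<lambda>\<omega>. \<alpha> * normalized_incr r G h x \<omega> + \<beta> * normalized_incr r G h y \<omega>)"
proof -
  define s where "s = fbm_sigma r h"
  have "(\<lambda>\<omega>. \<alpha> * normalized_incr r G h x \<omega> + \<beta> * normalized_incr r G h y \<omega>) =
    (\<lambda>\<omega>. \<alpha> / s * G (x + h) \<omega> + - \<alpha> / s * G x \<omega> + \<beta> / s * G (y + h) \<omega> + - \<beta> / s * G y \<omega>)"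
    by (auto simp: normalized_incr_def s_def[symmetric] diff_divide_distrib right_diff_distrib)
  then show ?thesis using fbm_gaussian by presburger
qed

lemma normalized_incr_moments:
  assumes h: "0 < h"
  shows "expectation (normalized_incr r G h x) = 0"
    and "expectation (\<lambda>\<omega>. (normalized_incr r G h x \<omega>)\<^sup>2) = 1"
    and "expectation (\<lambda>\<omega>. normalized_incr r G h x \<omega> * normalized_incr r G h y \<omega>) = increment_correlation r h (x - y)"
proof -
  note s = fbm_sigma_square[OF h]
  have "normalized_incr r G h x = (\<lambda>\<omega>. (G (x + h) \<omega> - G x \<omega>) / fbm_sigma r h)"
    by (auto simp: normalized_incr_def)
  then show "expectation (normalized_incr r G h x) = 0"
    using fbm_integrable fbm_mean by simp
  show "expectation (\<lambda>\<omega>. (normalized_incr r G h x \<omega>)\<^sup>2) = 1"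
    unfolding normalized_incr_def power_divide s(1) using h by (simp add: fbm_incr_square)
  have "(\<lambda>\<omega>. normalized_incr r G h x \<omega> * normalized_incr r G h y \<omega>) =
      (\<lambda>\<omega>. (G (x + h) \<omega> - G x \<omega>) * (G (y + h) \<omega> - G y \<omega>) / h powr r)"
    by (auto simp: normalized_incr_def s(1)[symmetric] power2_eq_square)
  then show "expectation (\<lambda>\<omega>. normalized_incr r G h x \<omega> * normalized_incr r G h y \<omega>) = increment_correlation r h (x - y)"
    by (simp add: fbm_incr_covariance increment_correlation_def)
qed

context
  fixes f :: "real \<Rightarrow> real" and \<kappa> :: real
  assumes f: "dalembert f \<kappa>"
begin

lemma dalembert_continuous: "continuous_on S f"
  using f continuous_on_subset unfolding dalembert_def by blast

text \<open>The strip around the diagonal has half-width \<open>\<delta> = sqrt h\<close>: it tends to 0, while the distance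
\<open>sqrt h\<close> is large compared with the step \<open>h\<close>, so the correlations off the strip are small too.
Both contributions are powers of \<open>h\<close>. The condition \<open>h \<le> 1 / 4\<close> means \<open>2 * h \<le> sqrt h\<close>, which puts
the points off the strip in the range of the decay estimate.\<close>
lemma dalembert_average_second_moment:
  assumes h: "0 < h" and ab: "a \<le> b"
  defines "V \<equiv> \<lambda>\<omega>. integral {a..b} (\<lambda>x. f (normalized_incr r G h x \<omega>) - exp \<kappa>)"
    and "K \<equiv> exp (2 * \<kappa>) * (cosh (2 * \<kappa>) - 1)"
  shows "integrable M (\<lambda>\<omega>. (V \<omega>)\<^sup>2)"
    and "h \<le> 1 / 4 \<Longrightarrow> expectation (\<lambda>\<omega>. (V \<omega>)\<^sup>2)
      \<le> (b - a) * (2 * sqrt h * K + K * (2 * (2 * sqrt h) powr (2 - r)) * (b - a))"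
proof -
  let ?Z = "normalized_incr r G h"
  let ?Y = "\<lambda>x \<omega>. f (?Z x \<omega>) - exp \<kappa>"
  have fm [measurable]: "f \<in> borel_measurable borel"
    by (rule borel_measurable_continuous_onI[OF dalembert_continuous])
  have Zm: "?Z x \<in> borel_measurable M" for x
    unfolding normalized_incr_def[abs_def] by measurable
  have Ym: "?Y x \<in> borel_measurable M" for x
    using Zm[of x] by measurable
  have Yc: "continuous_on UNIV (\<lambda>x. ?Y x \<omega>)" if "\<omega> \<in> space M" for \<omega>
    by (intro continuous_on_diff continuous_on_const
        continuous_on_compose2[OF dalembert_continuous normalized_incr_continuous[OF that]]) auto
  have "gaussian_rv M (\<lambda>\<omega>. ?Z x \<omega> + ?Z y \<omega>)" "gaussian_rv M (\<lambda>\<omega>. ?Z x \<omega> - ?Z y \<omega>)"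
      "gaussian_rv M (?Z x)" "gaussian_rv M (?Z y)" for x y
    using normalized_incr_gaussian[OF h, of 1 x 1 y] normalized_incr_gaussian[OF h, of 1 x "-1" y]
      normalized_incr_gaussian[OF h, of 1 x 0 y] normalized_incr_gaussian[OF h, of 0 x 1 y] by simp_all
  note cor = dalembert_correlated[OF prob_space_axioms f this
      normalized_incr_moments(1)[OF h] normalized_incr_moments(1)[OF h]
      normalized_incr_moments(2)[OF h] normalized_incr_moments(2)[OF h] normalized_incr_moments(3)[OF h], folded K_def]
  have K: "0 \<le> K" using cosh_real_ge_1[of "2 * \<kappa>"] by (simp add: K_def)
  have bnd: "\<bar>expectation (\<lambda>\<omega>. ?Y x \<omega> * ?Y y \<omega>)\<bar> \<le> K" for x y
    using cor(2)[of x y] mult_left_mono[OF cor(3)[of x y] K] by simp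
  show "integrable M (\<lambda>\<omega>. (V \<omega>)\<^sup>2)"
    unfolding V_def
    by (rule second_moment_integral(1)[OF prob_space_axioms ab, of 0 K K]) (use K Ym Yc cor(1) bnd in auto)
  assume h4: "h \<le> 1 / 4"
  have sq: "2 * h \<le> sqrt h"
  proof -
    have "sqrt h \<le> sqrt ((1/2)\<^sup>2)" using h4 by (intro real_sqrt_le_mono) (simp add: power2_eq_square)
    also have "sqrt ((1/2)\<^sup>2) = (1/2 :: real)" by (rule real_sqrt_unique) auto
    finally have "2 * sqrt h * sqrt h \<le> 1 * sqrt h" using h by (intro mult_right_mono) auto
    moreover have "sqrt h * sqrt h = h" using h by simp
    ultimately show ?thesis by (simp only: mult.assoc mult_1)
  qed
  have far: "\<bar>expectation (\<lambda>\<omega>. ?Y x \<omega> * ?Y y \<omega>)\<bar> \<le> K * (2 * (2 * sqrt h) powr (2 - r))"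
    if d: "sqrt h < \<bar>x - y\<bar>" for x y
  proof -
    have "\<bar>increment_correlation r h (x - y)\<bar> \<le> 2 * (sqrt h / (2 * h)) powr (r - 2)"
      using d by (intro increment_correlation_decay[OF r h sq]) simp
    also have "sqrt h / (2 * h) = inverse (2 * sqrt h)" using h by (simp add: field_simps)
    also have "(inverse (2 * sqrt h)) powr (r - 2) = (2 * sqrt h) powr (2 - r)"
      using h inverse_powr[of "2 * sqrt h" "r - 2"] powr_minus[of "2 * sqrt h" "r - 2"]
      by (metis minus_diff_eq mult_nonneg_nonneg real_sqrt_ge_zero less_imp_le zero_le_numeral)
    finally show ?thesis using cor(2)[of x y] mult_left_mono[OF _ K] by (meson order_trans)
  qed
  show "expectation (\<lambda>\<omega>. (V \<omega>)\<^sup>2)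
      \<le> (b - a) * (2 * sqrt h * K + K * (2 * (2 * sqrt h) powr (2 - r)) * (b - a))"
    unfolding V_def
    by (rule second_moment_integral(2)[OF prob_space_axioms ab]) (use h K Ym Yc cor(1) bnd far in auto)
qed

text \<open>Along \<open>h = q ^ n\<close> the second moments of the centred averages are eventually bounded by a sum of two
geometric sequences.\<close>
lemma dalembert_average_converges:
  assumes q: "0 < q" "q < 1" and ab: "a \<le> b"
  shows "averages_to_normal M (\<lambda>n. normalized_incr r G (q ^ n)) a b f"
proof -
  define V where "V = (\<lambda>n \<omega>. integral {a..b} (\<lambda>x. f (normalized_incr r G (q ^ n) x \<omega>) - exp \<kappa>))"
  define K where "K = exp (2 * \<kappa>) * (cosh (2 * \<kappa>) - 1)"
  have qn: "0 < q ^ n" for n using q by simp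
  have sqn: "sqrt (q ^ n) = sqrt q ^ n" for n by (simp add: real_sqrt_power)
  have pw: "(2 * sqrt q ^ n) powr (2 - r) = 2 powr (2 - r) * ((sqrt q) powr (2 - r)) ^ n" for n
  proof -
    have "(sqrt q ^ n) powr (2 - r) = (sqrt q powr real n) powr (2 - r)" using q by (simp add: powr_realpow)
    also have "\<dots> = ((sqrt q) powr (2 - r)) ^ n" using q by (simp add: powr_powr powr_power)
    finally show ?thesis using q by (simp add: powr_mult)
  qed
  have s1: "sqrt q < 1" using q by simp
  have s2: "sqrt q powr (2 - r) < 1"
    using powr_less_mono2[of "2 - r" "sqrt q" 1] q r s1 by simp
  have "summable (\<lambda>n. expectation (\<lambda>\<omega>. (V n \<omega>)\<^sup>2))"
  proof (rule summable_comparison_test_ev)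
    have "eventually (\<lambda>n. q ^ n < 1 / 4) sequentially"
      using LIMSEQ_power_zero[of q] q by (intro order_tendstoD) auto
    then show "eventually (\<lambda>n. norm (expectation (\<lambda>\<omega>. (V n \<omega>)\<^sup>2)) \<le>
        (b - a) * (2 * K * sqrt q ^ n + (2 * K * 2 powr (2 - r) * (b - a)) * (sqrt q powr (2 - r)) ^ n)) sequentially"
    proof eventually_elim
      case (elim n)
      have "0 \<le> expectation (\<lambda>\<omega>. (V n \<omega>)\<^sup>2)" by simp
      then show ?case
        using dalembert_average_second_moment(2)[OF qn[of n] ab] elim
        unfolding V_def K_def sqn pw by (simp add: mult_ac)
    qed
    show "summable (\<lambda>n. (b - a) * (2 * K * sqrt q ^ n + (2 * K * 2 powr (2 - r) * (b - a)) * (sqrt q powr (2 - r)) ^ n))"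
      using q s1 s2 by (intro summable_mult summable_add summable_geometric) auto
  qed
  then have "AE \<omega> in M. (\<lambda>n. V n \<omega>) \<longlonglongrightarrow> 0"
    using dalembert_average_second_moment(1)[OF qn ab] unfolding V_def
    by (intro AE_tendsto_0_of_summable_second_moments) auto
  then have "AE \<omega> in M. (\<lambda>n. integral {a..b} (\<lambda>x. f (normalized_incr r G (q ^ n) x \<omega>))) \<longlonglongrightarrow> exp \<kappa> * (b - a)"
    using AE_space
  proof eventually_elim
    case (elim \<omega>)
    have "V n \<omega> = integral {a..b} (\<lambda>x. f (normalized_incr r G (q ^ n) x \<omega>)) - exp \<kappa> * (b - a)" for n
    proof -
      have "(\<lambda>x. f (normalized_incr r G (q ^ n) x \<omega>)) integrable_on {a..b}"
        by (rule path_integrable[OF normalized_incr_continuous dalembert_continuous elim(2)])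
      then show ?thesis unfolding V_def using ab by (subst integral_diff) auto
    qed
    then show ?case using elim(1) by (simp add: LIM_zero_iff)
  qed
  moreover have "integrable lborel (\<lambda>x. std_normal_density x * f (1 * x)) \<and>
      (\<integral>x. std_normal_density x * f (1 * x) \<partial>lborel) = exp (\<kappa> * 1\<^sup>2)"
    using f unfolding dalembert_def by blast
  ultimately show ?thesis unfolding averages_to_normal_def using dalembert_continuous by simp
qed

end

lemma fbm_geometric_limit:
  assumes q: "0 < q" "q < 1" and ab: "a \<le> b" and p: "1 \<le> p"
  shows "AE \<omega> in M. (\<lambda>n. incr_int p (\<lambda>x. G x \<omega>) (q ^ n) a b / (q ^ n) powr (r / 2 * p))
    \<longlonglongrightarrow> (\<integral>x. std_normal_density x * \<bar>x\<bar> powr p \<partial>lborel) * (b - a)"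
proof -
  have "averages_to_normal M (\<lambda>n. normalized_incr r G (q ^ n)) a b (\<lambda>x. \<bar>x\<bar> powr p)"
    by (intro averages_to_normal_powr normalized_incr_continuous ab p
        dalembert_average_converges[OF dalembert_cos q ab] dalembert_average_converges[OF dalembert_cosh q ab])
  moreover have "integral {a..b} (\<lambda>x. \<bar>normalized_incr r G (q ^ n) x \<omega>\<bar> powr p) =
      incr_int p (\<lambda>x. G x \<omega>) (q ^ n) a b / (q ^ n) powr (r / 2 * p)" for n \<omega>
    using q by (simp add: normalized_incr_def fbm_sigma_def incr_int_def powr_divide powr_powr)
  ultimately show ?thesis unfolding averages_to_normal_def by simp
qed

end

theorem theorem2p3:
  fixes M :: "'a measure" and G :: "real \<Rightarrow> 'a \<Rightarrow> real"
    and N :: "'b measure" and \<eta> :: "'b \<Rightarrow> real"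
    and r p :: real
  assumes "0 < r" and "r < 2"
    and "fractional_brownian_motion M r G"
    and "prob_space N" and "distributed N lborel \<eta> std_normal_density"
    and "1 \<le> p"
  shows "AE \<omega> in M. \<forall>a b. a < b \<longrightarrow>
     ((\<lambda>h. LBINT x:{a..b}. \<bar>(G (x + h) \<omega> - G x \<omega>) / fbm_sigma r h\<bar> powr p)
        \<longlongrightarrow> prob_space.expectation N (\<lambda>\<xi>. \<bar>\<eta> \<xi>\<bar> powr p) * (b - a)) (at 0)"
proof -
  define c where "c = (\<integral>x. std_normal_density x * \<bar>x\<bar> powr p \<partial>lborel)"
  have c_eta: "prob_space.expectation N (\<lambda>\<xi>. \<bar>\<eta> \<xi>\<bar> powr p) = c"
    unfolding c_def using distributed_integral[OF assms(5), of "\<lambda>x. \<bar>x\<bar> powr p"] by simp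
  have c0: "0 \<le> c" unfolding c_def by (intro Bochner_Integration.integral_nonneg_AE AE_I2) auto
  have "AE \<omega> in M. a \<le> b \<longrightarrow> (\<forall>m. (\<lambda>n. incr_int p (\<lambda>x. G x \<omega>) ((real (Suc m) / real (m + 2)) ^ n) a b
      / ((real (Suc m) / real (m + 2)) ^ n) powr (r / 2 * p)) \<longlonglongrightarrow> c * (b - a))" for a b
  proof (cases "a \<le> b")
    case True
    have "AE \<omega> in M. \<forall>m. (\<lambda>n. incr_int p (\<lambda>x. G x \<omega>) ((real (Suc m) / real (m + 2)) ^ n) a b
      / ((real (Suc m) / real (m + 2)) ^ n) powr (r / 2 * p)) \<longlonglongrightarrow> c * (b - a)"
      unfolding c_def AE_all_countable
      by (intro allI fbm_geometric_limit[OF assms(1-3)] assms(6) True) auto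
    then show ?thesis by eventually_elim simp
  qed simp
  then have "AE \<omega> in M. \<forall>a\<in>\<rat>. \<forall>b\<in>\<rat>. a \<le> b \<longrightarrow> (\<forall>m. (\<lambda>n. incr_int p (\<lambda>x. G x \<omega>) ((real (Suc m) / real (m + 2)) ^ n) a b
      / ((real (Suc m) / real (m + 2)) ^ n) powr (r / 2 * p)) \<longlonglongrightarrow> c * (b - a))"
    by (intro AE_ball_countable[OF countable_rat, THEN iffD2] ballI)
  then show ?thesis
    using AE_space
  proof eventually_elim
    case (elim \<omega>)
    let ?g = "\<lambda>x. G x \<omega>"
    have g: "continuous_on UNIV ?g" using fbm_continuous[OF assms(1-3) elim(2)] .
    have lim: "((\<lambda>h. incr_int p ?g h a b / h powr (r / 2 * p)) \<longlongrightarrow> c * (b - a)) (at_right 0)"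
      if ab: "a \<in> \<rat>" "b \<in> \<rat>" "a < b" for a b
    proof -
      \<comment> \<open>A rational interval around \<open>[a, b]\<close>, with room for steps up to 2; it carries the
          dyadic bound, which is the case \<open>m = 0\<close> of the geometric limits.\<close>
      define R :: real where "R = of_int \<lceil>max \<bar>a\<bar> \<bar>b\<bar> + 2\<rceil>"
      have R: "R \<in> \<rat>" "-R \<in> \<rat>" "0 < R" "-R \<le> a" "b + 2 \<le> R" unfolding R_def by (auto; linarith)+
      show ?thesis
      proof (rule limit_from_geometric[OF assms(6) g _ _ _ R(3,4,5)])
        show "(\<lambda>n. incr_int p ?g ((1/2) ^ n) (-R) R / ((1/2) ^ n) powr (r / 2 * p)) \<longlonglongrightarrow> c * (R - (-R))"
          using elim(1)[rule_format, OF R(2,1), of 0] R(3) by simp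
        show "(\<lambda>n. incr_int p ?g ((real (Suc m) / real (m + 2)) ^ n) a b
            / ((real (Suc m) / real (m + 2)) ^ n) powr (r / 2 * p)) \<longlonglongrightarrow> c * (b - a)" for m
          using elim(1)[rule_format, OF ab(1,2)] ab(3) by simp
      qed (use assms ab c0 in auto)
    qed
    show ?case
    proof (intro allI impI)
      fix a b :: real assume ab: "a < b"
      have eq: "(LBINT x:{a..b}. \<bar>(G (x + h) \<omega> - G x \<omega>) / fbm_sigma r h\<bar> powr p) =
          incr_int p ?g h a b / \<bar>h\<bar> powr (r / 2 * p)" for h
      proof -
        have "continuous_on {a..b} (\<lambda>x. \<bar>(G (x + h) \<omega> - G x \<omega>) * inverse (fbm_sigma r h)\<bar> powr p)"
          by (intro continuous_on_abs_powr assms continuous_on_mult continuous_on_const continuous_incr g)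
        then have "(LBINT x:{a..b}. \<bar>(G (x + h) \<omega> - G x \<omega>) / fbm_sigma r h\<bar> powr p) =
            integral {a..b} (\<lambda>x. \<bar>(G (x + h) \<omega> - G x \<omega>) / fbm_sigma r h\<bar> powr p)"
          unfolding divide_inverse[symmetric]
          by (intro set_borel_integral_eq_integral(2) borel_integrable_atLeastAtMost')
        also have "\<dots> = incr_int p ?g h a b / \<bar>h\<bar> powr (r / 2 * p)"
          by (simp add: fbm_sigma_def incr_int_def powr_divide powr_powr)
        finally show ?thesis .
      qed
      show "((\<lambda>h. LBINT x:{a..b}. \<bar>(G (x + h) \<omega> - G x \<omega>) / fbm_sigma r h\<bar> powr p)
        \<longlongrightarrow> prob_space.expectation N (\<lambda>\<xi>. \<bar>\<eta> \<xi>\<bar> powr p) * (b - a)) (at 0)"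
        unfolding c_eta eq by (rule limit_from_rational_intervals[OF assms(6) g c0 ab lim])
    qed
  qed
qed

end
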